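(* Let $\mathcal{D}$ be a deformation space of $G$-trees, let $\mathcal{A}_{min}$ be the family of bi-elliptic subgroups of reduced trees of $\mathcal{D}$, and let $\mathcal{D}_r$ be the reduced deformation space. Let $G_0\notin\mathcal{A}_{min}$ be a maximal elliptic subgroup, with peripheral structure $\mathcal{M}_0$. Given $T\in\mathcal{D}_r$, let $v$ be the (unique) vertex of $T$ with stabilizer $G_0$. (1) If an edge $e$ is adjacent to $v$, there exists $m\in\mathcal{M}_0$ such that $G_e$ is contained in a group belonging to $m$. (2) Given $m\in\mathcal{M}_0$, there exists an edge $e$ adjacent to $v$ such that $G_e$ belongs to $m$. (3) The image $\bar v$ of $v$ in the quotient graph $\Gamma=T/G$ has valence at least $|\mathcal{M}_0|$. In particular, $\mathcal{M}_0$ is finite. (4) There exists $T'\in\mathcal{D}_r$ such that equality holds in (3): the valence in $T'/G$ of the image of the vertex of $T'$ with stabilizer $G_0$ is $|\mathcal{M}_0|$.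
   Context: $G$ is a finitely generated group. A $G$-tree is a simplicial tree $T$ with an action of $G$ by simplicial automorphisms without inversions, always assumed minimal (no proper $G$-invariant subtree). $G_v,G_e$ denote vertex and edge stabilizers. A subgroup of $G$ is elliptic in $T$ if it fixes a point of $T$. A deformation space $\mathcal{D}$ is the set of all $G$-trees having the same elliptic subgroups as a given $G$-tree; elliptic refers to these subgroups. $T$ is reduced if, whenever an edge $e=vw$ satisfies $G_e=G_v$, the vertices $v$ and $w$ are in the same $G$-orbit. A subgroup is bi-elliptic in $T$ if it is contained in an edge stabilizer of $T$. All reduced trees in $\mathcal{D}$ have the same bi-elliptic subgroups; $\mathcal{A}_{min}$ is the family of these subgroups. The reduced deformation space $\mathcal{D}_r$ is the set of $T\in\mathcal{D}$ all of whose edge stabilizers belong to $\mathcal{A}_{min}$. If $T\in\mathcal{D}_r$, a maximal elliptic subgroup $G_0\notin\mathcal{A}_{min}$ is the stabilizer of a unique vertex of $T$. Peripheral structure: consider all subgroups $H\subset G_0$ belonging to $\mathcal{A}_{min}$. For two such groups, write $H\le K$ if $H\subset gKg^{-1}$ for some $g\in G_0$, and $H\sim K$ if $H\le K$ and $K\le H$. $\mathcal{M}_0$ is the set of maximal elements of the partially ordered set of equivalence classes. An element $m\in\mathcal{M}_0$ is thus a family of subgroups of $G_0$, stable under conjugation by $G_0$. *)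

theory Defs
  imports
    "HOL-Algebra.Group_Action"
    "HOL-Algebra.Generated_Groups"
    "HOL-Library.Extended_Nat"
    "Graph_Theory.Digraph_Component"
begin

definition finitely_generated_group :: "('g, 'x) monoid_scheme \<Rightarrow> bool" where
  "finitely_generated_group G \<longleftrightarrow>
     group G \<and> (\<exists>S. finite S \<and> S \<subseteq> carrier G \<and> generate G S = carrier G)"

section \<open>Trees with a group action\<close>

text \<open>
  A simplicial tree is a non-empty connected graph without circuits. Graphs are loop-free
  symmetric digraphs, so every geometric edge appears as two opposite arcs (oriented edges).
  The library predicate \<^const>\<open>tree\<close> forbids directed cycles and hence cannot be used
  for symmetric digraphs, where \<open>(u,w), (w,u)\<close> counts as a cycle; genuine circuits are
  the cycles of length at least 3. Non-emptiness is part of \<^const>\<open>Digraph_Component.connected\<close>.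
\<close>

definition simplicial_tree :: "'v pair_pre_digraph \<Rightarrow> bool" where
  "simplicial_tree X \<longleftrightarrow>
     pair_bidirected_digraph X \<and>
     Digraph_Component.connected (with_proj X) \<and>
     \<not> (\<exists>c. pre_digraph.cycle (with_proj X) c \<and> length c \<ge> 3)"

record ('g, 'v) acted_graph =
  graph_of :: "'v pair_pre_digraph"
  act :: "'g \<Rightarrow> 'v \<Rightarrow> 'v"

abbreviation tverts :: "('g, 'v) acted_graph \<Rightarrow> 'v set" where
  "tverts T \<equiv> pverts (graph_of T)"

abbreviation tarcs :: "('g, 'v) acted_graph \<Rightarrow> ('v \<times> 'v) set" where
  "tarcs T \<equiv> parcs (graph_of T)"

definition arc_act :: "('g, 'v) acted_graph \<Rightarrow> 'g \<Rightarrow> 'v \<times> 'v \<Rightarrow> 'v \<times> 'v" where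
  "arc_act T g = map_prod (act T g) (act T g)"

definition invariant_subtree ::
    "('g, 'x) monoid_scheme \<Rightarrow> ('g, 'v) acted_graph \<Rightarrow> 'v pair_pre_digraph \<Rightarrow> bool" where
  "invariant_subtree G T S \<longleftrightarrow>
     simplicial_tree S \<and> subgraph (with_proj S) (with_proj (graph_of T)) \<and>
     (\<forall>g\<in>carrier G. act T g ` pverts S = pverts S \<and> arc_act T g ` parcs S = parcs S)"

text \<open>
  The conjuncts: an action on the vertex set, by automorphisms, without inversions, minimal.
\<close>

definition is_G_tree :: "('g, 'x) monoid_scheme \<Rightarrow> ('g, 'v) acted_graph \<Rightarrow> bool" where
  "is_G_tree G T \<longleftrightarrow>
     simplicial_tree (graph_of T) \<and>
     group_action G (tverts T) (act T) \<and>
     (\<forall>g\<in>carrier G. arc_act T g ` tarcs T = tarcs T) \<and>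
     (\<forall>g\<in>carrier G. \<forall>e\<in>tarcs T. arc_act T g e \<noteq> prod.swap e) \<and>
     (\<forall>S. invariant_subtree G T S \<longrightarrow> S = graph_of T)"

definition vertex_stab :: "('g, 'x) monoid_scheme \<Rightarrow> ('g, 'v) acted_graph \<Rightarrow> 'v \<Rightarrow> 'g set" where
  "vertex_stab G T v = stabilizer G (act T) v"

text \<open>
  Since there are no inversions, the stabilizer of an arc is also the setwise stabilizer of
  the underlying geometric edge. For the same reason a subgroup fixes a point of the geometric
  realization iff it fixes a vertex.
\<close>

definition edge_stab :: "('g, 'x) monoid_scheme \<Rightarrow> ('g, 'v) acted_graph \<Rightarrow> 'v \<times> 'v \<Rightarrow> 'g set" where
  "edge_stab G T e = stabilizer G (arc_act T) e"

definition elliptic :: "('g, 'x) monoid_scheme \<Rightarrow> ('g, 'v) acted_graph \<Rightarrow> 'g set \<Rightarrow> bool" where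
  "elliptic G T H \<longleftrightarrow> subgroup H G \<and> (\<exists>x\<in>tverts T. \<forall>h\<in>H. act T h x = x)"

definition bi_elliptic :: "('g, 'x) monoid_scheme \<Rightarrow> ('g, 'v) acted_graph \<Rightarrow> 'g set \<Rightarrow> bool" where
  "bi_elliptic G T H \<longleftrightarrow> subgroup H G \<and> (\<exists>e\<in>tarcs T. H \<subseteq> edge_stab G T e)"

definition reduced :: "('g, 'x) monoid_scheme \<Rightarrow> ('g, 'v) acted_graph \<Rightarrow> bool" where
  "reduced G T \<longleftrightarrow>
     (\<forall>(u, w)\<in>tarcs T. edge_stab G T (u, w) = vertex_stab G T u \<longrightarrow> w \<in> orbit G (act T) u)"

section \<open>Quotient graph and valence\<close>

text \<open>
  Vertices and arcs of \<open>T/G\<close> are the orbits of vertices and arcs of \<open>T\<close>. The tails (heads) of the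
  arcs in an arc orbit form a vertex orbit. The valence of a vertex is the number of arcs
  leaving it; as there are no inversions, a loop of \<open>T/G\<close> yields two distinct arcs and so
  contributes 2.
\<close>

definition quotient_graph ::
    "('g, 'x) monoid_scheme \<Rightarrow> ('g, 'v) acted_graph \<Rightarrow> ('v set, ('v \<times> 'v) set) pre_digraph" where
  "quotient_graph G T =
     \<lparr> verts = orbit G (act T) ` tverts T,
       arcs = orbit G (arc_act T) ` tarcs T,
       tail = (\<lambda>A. fst ` A),
       head = (\<lambda>A. snd ` A) \<rparr>"

definition valence :: "('a, 'b) pre_digraph \<Rightarrow> 'a \<Rightarrow> enat" where
  "valence X x = (if finite (out_arcs X x) then enat (out_degree X x) else \<infinity>)"

section \<open>Deformation spaces\<close>

text \<open>
  All trees of a deformation space have their vertices in one type \<open>'v\<close>. This loses no tree up to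
  equivariant isomorphism when \<open>G\<close> is finitely generated: a minimal tree that is not a point is
  then countably infinite, so if \<open>'v\<close> carries one such tree, it carries a copy of each of them.
  A deformation space containing a point consists of points only.
\<close>

definition deformation_space ::
    "('g, 'x) monoid_scheme \<Rightarrow> ('g, 'v) acted_graph set \<Rightarrow> bool" where
  "deformation_space G D \<longleftrightarrow>
     (\<exists>T0 :: ('g, 'v) acted_graph. is_G_tree G T0 \<and>
        D = {T. is_G_tree G T \<and> (\<forall>H. elliptic G T H \<longleftrightarrow> elliptic G T0 H)})"

definition elliptic_in ::
    "('g, 'x) monoid_scheme \<Rightarrow> ('g, 'v) acted_graph set \<Rightarrow> 'g set \<Rightarrow> bool" where
  "elliptic_in G D H \<longleftrightarrow> (\<exists>T\<in>D. elliptic G T H)"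

definition maximal_elliptic ::
    "('g, 'x) monoid_scheme \<Rightarrow> ('g, 'v) acted_graph set \<Rightarrow> 'g set \<Rightarrow> bool" where
  "maximal_elliptic G D H \<longleftrightarrow>
     elliptic_in G D H \<and> (\<forall>K. elliptic_in G D K \<and> H \<subseteq> K \<longrightarrow> K = H)"

definition A_min ::
    "('g, 'x) monoid_scheme \<Rightarrow> ('g, 'v) acted_graph set \<Rightarrow> 'g set set" where
  "A_min G D = {H. \<exists>T\<in>D. reduced G T \<and> bi_elliptic G T H}"

definition reduced_deformation_space ::
    "('g, 'x) monoid_scheme \<Rightarrow> ('g, 'v) acted_graph set \<Rightarrow> ('g, 'v) acted_graph set" where
  "reduced_deformation_space G D = {T\<in>D. \<forall>e\<in>tarcs T. edge_stab G T e \<in> A_min G D}"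

section \<open>Peripheral structure\<close>

definition conj_le :: "('g, 'x) monoid_scheme \<Rightarrow> 'g set \<Rightarrow> 'g set \<Rightarrow> 'g set \<Rightarrow> bool" where
  "conj_le G G0 H K \<longleftrightarrow> (\<exists>g\<in>G0. H \<subseteq> g <#\<^bsub>G\<^esub> K #>\<^bsub>G\<^esub> inv\<^bsub>G\<^esub> g)"

definition peripheral_candidates :: "'g set set \<Rightarrow> 'g set \<Rightarrow> 'g set set" where
  "peripheral_candidates A G0 = {H\<in>A. H \<subseteq> G0}"

definition peripheral_classes ::
    "('g, 'x) monoid_scheme \<Rightarrow> 'g set set \<Rightarrow> 'g set \<Rightarrow> 'g set set set" where
  "peripheral_classes G A G0 =
     peripheral_candidates A G0 //
       {(H, K). H \<in> peripheral_candidates A G0 \<and> K \<in> peripheral_candidates A G0 \<and>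
                conj_le G G0 H K \<and> conj_le G G0 K H}"

definition class_le ::
    "('g, 'x) monoid_scheme \<Rightarrow> 'g set \<Rightarrow> 'g set set \<Rightarrow> 'g set set \<Rightarrow> bool" where
  "class_le G G0 m n \<longleftrightarrow> (\<exists>H\<in>m. \<exists>K\<in>n. conj_le G G0 H K)"

definition peripheral_structure ::
    "('g, 'x) monoid_scheme \<Rightarrow> 'g set set \<Rightarrow> 'g set \<Rightarrow> 'g set set set" where
  "peripheral_structure G A G0 =
     {m \<in> peripheral_classes G A G0.
        \<forall>n \<in> peripheral_classes G A G0. class_le G G0 m n \<longrightarrow> n = m}"

end

theory Submission
  imports Defs
begin

text \<open>
  Bi-elliptic subgroups of a reduced tree are bi-elliptic in every tree of the deformation space:
  if the end stabilizers of an edge have no common fixed point in the other tree, then the edge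
  group fixes a path between their fixed point sets; otherwise the edge group equals one end
  stabilizer, the edge joins \<open>u\<close> to \<open>g u\<close>, and the edge group fixes the path from \<open>x\<close> to \<open>g x\<close>
  for a fixed point \<open>x\<close>. Hence every subgroup of \<open>G0\<close> in \<open>A_min\<close> fixes an edge at \<open>v\<close>, and as there
  are finitely many orbits of edges, the maximal classes are among those of the edge groups at
  \<open>v\<close>. For the last claim choose one edge at \<open>v\<close> per class, insert a new edge (a ray) with the same
  stabilizer, and slide all edges at \<open>v\<close> to the far ends of rays. The new tree is minimal since at
  least two rays start at \<open>v\<close>, as \<open>G0\<close> is not in \<open>A_min\<close>.
\<close>

section \<open>Simplicial trees as symmetric relations\<close>

text \<open>Acyclicity is used in the form that every edge is a bridge: this passes to subgraphs at
  once and can be tested in a blow-up by projecting walks, without following circuits through the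
  new vertices. Maximal classes exist even among infinitely many candidate subgroups, because finite
  generation and minimality leave only finitely many edge orbits. The last claim meets three
  obstacles. Sliding must be equivariant; this works because the group of an edge at
  \<open>v\<close> is contained in that of some ray at \<open>v\<close> itself, not only up to
  conjugacy. Every ray must carry an edge at its far end, or it could be pruned; hence the ray
  modelled on an edge of \<open>T\<close> receives that very edge. Finally, the new vertices must
  live in the vertex type of \<open>T\<close>, so the vertex set of \<open>T\<close> is shown to be
  infinite before they are coded into it. The elliptic subgroups do not change, since
  \<open>T\<close> and the new tree map equivariantly to each other.\<close>

locale rel_tree =
  fixes V :: "'a set" and E :: "'a rel"
  assumes nonempty: "V \<noteq> {}"
    and arcs_sub: "E \<subseteq> V \<times> V"
    and arcs_sym: "(x, y) \<in> E \<Longrightarrow> (y, x) \<in> E"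
    and connected: "x \<in> V \<Longrightarrow> y \<in> V \<Longrightarrow> (x, y) \<in> E\<^sup>*"
    and bridge: "(x, y) \<in> E \<Longrightarrow> (x, y) \<notin> (E - {(x, y), (y, x)})\<^sup>*"

section \<open>Reachability and walks in symmetric digraphs\<close>

lemma rtrancl_sym_rel:
  assumes "\<And>a b. (a, b) \<in> R \<Longrightarrow> (b, a) \<in> R" "(x, y) \<in> R\<^sup>*"
  shows "(y, x) \<in> R\<^sup>*"
proof -
  have "sym R" using assms(1) by (auto intro: symI)
  then show ?thesis using sym_rtrancl assms(2) by (metis symD)
qed

lemma rtrancl_map:
  assumes "(x, y) \<in> R\<^sup>*" "\<And>a b. (a, b) \<in> R \<Longrightarrow> (f a, f b) \<in> S\<^sup>*"
  shows "(f x, f y) \<in> S\<^sup>*"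
  using assms(1) by induction (auto dest: assms(2))

lemma relpow_map:
  assumes "(x, y) \<in> R ^^ n" "\<And>a b. (a, b) \<in> R \<Longrightarrow> (f a, f b) \<in> R"
  shows "(f x, f y) \<in> R ^^ n"
  using assms(1) by (induction n arbitrary: y) (auto dest: assms(2))

lemma rtrancl_invariant:
  assumes "(x, y) \<in> R\<^sup>*" "x \<in> A" "\<And>a b. (a, b) \<in> R \<Longrightarrow> a \<in> A \<Longrightarrow> b \<in> A"
  shows "y \<in> A"
  using assms(1,2) by induction (auto dest: assms(3))

lemma rtrancl_finite_subrel:
  assumes "(x, y) \<in> R\<^sup>*"
  obtains R0 where "finite R0" "R0 \<subseteq> R" "(x, y) \<in> R0\<^sup>*"
proof -
  have "\<exists>R0. finite R0 \<and> R0 \<subseteq> R \<and> (x, y) \<in> R0\<^sup>*"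
    using assms
  proof induction
    case base then show ?case by auto
  next
    case (step y z)
    then obtain R0 where "finite R0" "R0 \<subseteq> R" "(x, y) \<in> R0\<^sup>*" by blast
    moreover have "(x, y) \<in> (insert (y, z) R0)\<^sup>*"
      using \<open>(x, y) \<in> R0\<^sup>*\<close> rtrancl_mono[of R0 "insert (y, z) R0"] by blast
    ultimately show ?case using step.hyps
      by (intro exI[of _ "insert (y, z) R0"]) (auto intro: rtrancl_into_rtrancl)
  qed
  with that show thesis by blast
qed

lemma awalk_imp_rtrancl:
  assumes "pcas x p y" "set p \<subseteq> R"
  shows "(x, y) \<in> R\<^sup>*"
  using assms by (induction p arbitrary: x) (auto intro: converse_rtrancl_into_rtrancl)

lemma (in pair_wf_digraph) rtrancl_imp_awalk:
  assumes "(x, y) \<in> (parcs G)\<^sup>*" "x \<in> pverts G"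
  obtains p where "awalk x p y"
proof -
  have "\<exists>p. awalk x p y"
    using assms
  proof (induction rule: converse_rtrancl_induct)
    case base
    then show ?case by (auto intro!: exI[of _ "[]"] simp: awalk_Nil_iff)
  next
    case (step a b)
    then obtain p where "awalk b p y" using in_arcsD2 by blast
    then show ?case using step.hyps step.prems
      by (auto intro!: exI[of _ "(a, b) # p"] simp: awalk_Cons_iff)
  qed
  with that show thesis by blast
qed

lemma pawalk_verts_nonempty [simp]: "pawalk_verts x p \<noteq> []"
  by (cases p) auto

lemma pcas_fst_in_verts: "pcas x p y \<Longrightarrow> e \<in> set p \<Longrightarrow> fst e \<in> set (pawalk_verts x p)"
  by (induction p arbitrary: x) auto

lemma pcas_snd_in_verts: "pcas x p y \<Longrightarrow> e \<in> set p \<Longrightarrow> snd e \<in> set (pawalk_verts x p)"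
proof (induction p arbitrary: x)
  case (Cons a p)
  then show ?case by (cases p) auto
qed simp

lemma pcas_last: "pcas x p y \<Longrightarrow> last (pawalk_verts x p) = y"
proof (induction p arbitrary: x)
  case (Cons a p)
  then show ?case by (cases p) auto
qed simp

lemma pcas_snoc: "pcas x p y \<Longrightarrow> pcas x (p @ [(y, z)]) z"
  by (induction p arbitrary: x) auto

lemma pawalk_verts_snoc: "pcas x p y \<Longrightarrow> pawalk_verts x (p @ [(y, z)]) = pawalk_verts x p @ [z]"
  by (induction p arbitrary: x) auto

text \<open>The rest of a circuit is a detour around its first arc: it meets \<open>y\<close> only
  at its start, so it never uses the edge between \<open>u\<close> and \<open>y\<close>
  again.\<close>

lemma rel_tree_no_cycle:
  assumes "rel_tree (pverts X) (parcs X)"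
  shows "\<not> (\<exists>c. pre_digraph.cycle (with_proj X) c \<and> length c \<ge> 3)"
proof (intro notI, elim exE conjE)
  fix c
  assume c: "pre_digraph.cycle (with_proj X) c" "length c \<ge> 3"
  interpret rel_tree "pverts X" "parcs X" by fact
  from c obtain u where c': "pcas u c u" "set c \<subseteq> parcs X" "distinct (tl (pawalk_verts u c))"
    unfolding pre_digraph.cycle_def pre_digraph.awalk_def
    by (auto simp: cas_with_proj_eq awalk_verts_with_proj_eq)
  from c(2) obtain a b es where c_eq: "c = a # b # es" and "es \<noteq> []"
    by (cases c; cases "tl c"; cases "tl (tl c)") auto
  obtain y z where ab: "a = (u, y)" "b = (y, z)"
    using c'(1) unfolding c_eq by (cases a; cases b) auto
  have es: "pcas z es u" using c'(1) c_eq ab by simp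
  have y: "y \<notin> set (pawalk_verts z es)" and dist: "distinct (pawalk_verts z es)"
    using c'(3) c_eq ab by auto
  \<comment> \<open>Length at least 3 enters here: \<open>es\<close> is nonempty, so with
    \<open>z = u\<close> it would visit \<open>u\<close> both at its start and at its end.\<close>
  have "z \<noteq> u"
  proof
    assume "z = u"
    with \<open>es \<noteq> []\<close> es dist obtain e es' where "es = e # es'" "pcas (snd e) es' u"
      "u \<notin> set (pawalk_verts (snd e) es')" by (cases es) auto
    then show False using pcas_last[of "snd e" es' u] by (metis last_in_set pawalk_verts_nonempty)
  qed
  have "set es \<subseteq> parcs X - {(u, y), (y, u)}"
    using pcas_fst_in_verts[OF es] pcas_snd_in_verts[OF es] y c'(2) c_eq by fastforce
  then have "(z, u) \<in> (parcs X - {(u, y), (y, u)})\<^sup>*"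
    using awalk_imp_rtrancl[OF es] by blast
  moreover have "y \<noteq> u" using bridge[of u y] c'(2) c_eq ab by auto
  then have "(y, z) \<in> parcs X - {(u, y), (y, u)}" using \<open>z \<noteq> u\<close> c'(2) c_eq ab by auto
  ultimately have "(y, u) \<in> (parcs X - {(u, y), (y, u)})\<^sup>*"
    by (meson converse_rtrancl_into_rtrancl)
  then have "(y, u) \<in> (parcs X - {(y, u), (u, y)})\<^sup>*" by (simp add: insert_commute)
  then show False using bridge[of y u] arcs_sym[of u y] c'(2) c_eq ab by auto
qed

text \<open>A detour around an arc shortens to a path; closed up by the reversed arc it becomes a
  circuit. Its length is at least 3 because the path is neither empty nor the removed arc
  itself.\<close>

lemma simplicial_tree_bridge:
  assumes "simplicial_tree X" "(x, y) \<in> parcs X"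
  shows "(x, y) \<notin> (parcs X - {(x, y), (y, x)})\<^sup>*"
proof
  assume *: "(x, y) \<in> (parcs X - {(x, y), (y, x)})\<^sup>*"
  interpret pair_bidirected_digraph X using assms(1) by (simp add: simplicial_tree_def)
  \<comment> \<open>Shortening a walk to a path is a fact about digraphs, so the relation without
    the edge is made into one.\<close>
  define X' where "X' = \<lparr>pverts = pverts X, parcs = parcs X - {(x, y), (y, x)}\<rparr>"
  interpret X': pair_wf_digraph X'
    by unfold_locales (auto simp: X'_def intro: in_arcsD1 in_arcsD2)
  have xV: "x \<in> pverts X" using assms(2) in_arcsD1 by blast
  obtain p where "X'.awalk x p y"
    using X'.rtrancl_imp_awalk[of x y] * xV by (auto simp: X'_def)
  then obtain q where "X'.apath x q y" using X'.apath_awalk_to_apath by blast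
  moreover have "parcs X' = parcs X - {(x, y), (y, x)}" by (simp add: X'_def)
  ultimately have q: "pcas x q y" "set q \<subseteq> parcs X - {(x, y), (y, x)}" "distinct (pawalk_verts x q)"
    by (auto simp: X'.apath_def X'.awalk_def)
  have "x \<noteq> y" using assms(2) pair_no_loops by fastforce
  have len: "length q \<ge> 2"
  proof (rule ccontr)
    assume "\<not> length q \<ge> 2"
    then consider "q = []" | e where "q = [e]" by (cases q; cases "tl q") auto
    then show False using q \<open>x \<noteq> y\<close> by cases auto
  qed
  have "awalk x (q @ [(y, x)]) x"
    using q pcas_snoc[OF q(1)] arcs_symmetric[OF assms(2)] xV by (auto simp: awalk_def)
  moreover have "distinct (tl (awalk_verts x (q @ [(y, x)])))"
  proof -
    obtain l where "pawalk_verts x q = x # l" using q(1) by (cases q) auto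
    then show ?thesis using q(3) by (simp add: pawalk_verts_snoc[OF q(1)])
  qed
  ultimately have "cycle (q @ [(y, x)])" unfolding cycle_def by blast
  moreover have "length (q @ [(y, x)]) \<ge> 3" using len by simp
  ultimately show False using assms(1) unfolding simplicial_tree_def by blast
qed

lemma connected_sym_iff:
  assumes "pair_bidirected_digraph X"
  shows "Digraph_Component.connected (with_proj X) \<longleftrightarrow>
    pverts X \<noteq> {} \<and> (\<forall>x\<in>pverts X. \<forall>y\<in>pverts X. (x, y) \<in> (parcs X)\<^sup>*)"
proof -
  interpret pair_bidirected_digraph X by fact
  have symc: "(parcs X)\<^sup>s = parcs X" by (auto simp: symcl_def arcs_symmetric)
  have "(x, y) \<in> rtrancl_on (pverts X) (parcs X) \<longleftrightarrow> (x, y) \<in> (parcs X)\<^sup>*"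
    if "x \<in> pverts X" for x y
  proof
    assume "(x, y) \<in> rtrancl_on (pverts X) (parcs X)"
    then show "(x, y) \<in> (parcs X)\<^sup>*"
      by (induction rule: rtrancl_on_induct) (auto intro: rtrancl_into_rtrancl)
  next
    assume "(x, y) \<in> (parcs X)\<^sup>*"
    then show "(x, y) \<in> rtrancl_on (pverts X) (parcs X)"
      using that
      by induction (auto intro: rtrancl_on_into_rtrancl_on in_arcsD1 in_arcsD2)
  qed
  then show ?thesis unfolding connected_conv symc with_proj_simps by auto
qed

lemma simplicial_tree_iff: "simplicial_tree X \<longleftrightarrow> rel_tree (pverts X) (parcs X)"
proof
  assume t: "simplicial_tree X"
  then interpret pair_bidirected_digraph X by (simp add: simplicial_tree_def)
  show "rel_tree (pverts X) (parcs X)"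
    using t connected_sym_iff[of X] simplicial_tree_bridge[OF t]
    by unfold_locales
      (auto simp: simplicial_tree_def arcs_symmetric intro: in_arcsD1 in_arcsD2)
next
  assume t: "rel_tree (pverts X) (parcs X)"
  then interpret rel_tree "pverts X" "parcs X" .
  have "fst e \<noteq> snd e" if "e \<in> parcs X" for e
    using bridge[of "fst e" "snd e"] that by (cases e) auto
  moreover have "sym (parcs X)" using arcs_sym by (auto intro: symI)
  ultimately have "pair_bidirected_digraph X"
    using arcs_sub by unfold_locales (auto simp: symmetric_def)
  then show "simplicial_tree X"
    using rel_tree_no_cycle[OF t] connected_sym_iff[of X] nonempty connected
    by (auto simp: simplicial_tree_def)
qed

section \<open>Distance to a root, geodesics and subtrees\<close>

context rel_tree
begin

lemma irrefl: "(x, x) \<notin> E"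
  using bridge[of x x] by auto

lemma arcs_in: "(x, y) \<in> E \<Longrightarrow> x \<in> V" "(x, y) \<in> E \<Longrightarrow> y \<in> V"
  using arcs_sub by auto

definition gdist :: "'a \<Rightarrow> 'a \<Rightarrow> nat" where
  "gdist r x = (LEAST n. (x, r) \<in> E ^^ n)"

lemma gdist_relpow: "r \<in> V \<Longrightarrow> x \<in> V \<Longrightarrow> (x, r) \<in> E ^^ gdist r x"
  unfolding gdist_def using connected[of x r] by (auto dest: rtrancl_imp_relpow intro: LeastI)

lemma gdist_le: "(x, r) \<in> E ^^ n \<Longrightarrow> gdist r x \<le> n"
  unfolding gdist_def by (rule Least_le)

lemma gdist_self [simp]: "gdist r r = 0"
  using gdist_le[of r r 0] by simp

lemma gdist_arc_le:
  assumes "r \<in> V" "(x, y) \<in> E"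
  shows "gdist r x \<le> Suc (gdist r y)"
  using gdist_le[of x r "Suc (gdist r y)"] gdist_relpow[of r y] assms arcs_in
  by (meson relpow_Suc_I2)

lemma closer_neighbour:
  assumes "r \<in> V" "x \<in> V" "x \<noteq> r"
  obtains u where "(x, u) \<in> E" "gdist r x = Suc (gdist r u)"
proof -
  have *: "(x, r) \<in> E ^^ gdist r x" using assms gdist_relpow by blast
  then obtain n where n: "gdist r x = Suc n" using assms(3) by (cases "gdist r x") auto
  then obtain u where u: "(x, u) \<in> E" "(u, r) \<in> E ^^ n"
    using * by (metis relpow_Suc_D2)
  then have "gdist r x = Suc (gdist r u)"
    using gdist_le[OF u(2)] gdist_arc_le[OF assms(1) u(1)] n by linarith
  with u that show thesis by blast
qed

text \<open>The bound \<open>n\<close> lets a descent avoid a chosen arc: no arc between equal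
  levels and no arc with an end above level \<open>n\<close> belongs to it.\<close>

definition descending :: "'a \<Rightarrow> nat \<Rightarrow> 'a rel" where
  "descending r n = {(a, b) \<in> E. gdist r b < gdist r a \<and> gdist r a \<le> n}"

lemma descending_path:
  assumes "r \<in> V" "x \<in> V"
  shows "(x, r) \<in> (descending r (gdist r x))\<^sup>*"
  using assms(2)
proof (induction "gdist r x" arbitrary: x rule: less_induct)
  case less
  show ?case
  proof (cases "x = r")
    case False
    then obtain u where u: "(x, u) \<in> E" "gdist r x = Suc (gdist r u)"
      using closer_neighbour assms(1) less.prems by blast
    then have "(u, r) \<in> (descending r (gdist r u))\<^sup>*"
      using less.hyps[of u] arcs_in by auto
    moreover have "descending r (gdist r u) \<subseteq> descending r (gdist r x)"
      using u by (auto simp: descending_def)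
    ultimately have "(u, r) \<in> (descending r (gdist r x))\<^sup>*"
      using rtrancl_mono by blast
    moreover have "(x, u) \<in> descending r (gdist r x)" using u by (auto simp: descending_def)
    ultimately show ?thesis by (rule converse_rtrancl_into_rtrancl[rotated])
  qed auto
qed

text \<open>From ends at equal level, two descents to the root never cross the arc between them, so
  together they would bypass a bridge.\<close>

lemma gdist_arc_neq:
  assumes r: "r \<in> V" and xy: "(x, y) \<in> E"
  shows "gdist r x \<noteq> gdist r y"
proof
  assume eq: "gdist r x = gdist r y"
  define R where "R = E - {(x, y), (y, x)}"
  have sym: "(b, a) \<in> R" if "(a, b) \<in> R" for a b using that arcs_sym by (auto simp: R_def)
  have "descending r n \<subseteq> R" for n using eq by (auto simp: descending_def R_def)
  then have "(x, r) \<in> R\<^sup>*" "(y, r) \<in> R\<^sup>*"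
    using descending_path[OF r] arcs_in[OF xy] rtrancl_mono by blast+
  then have "(x, y) \<in> R\<^sup>*" using rtrancl_sym_rel[of R, OF sym] by (meson rtrancl_trans)
  then show False using bridge[OF xy] by (simp add: R_def)
qed

text \<open>With two such neighbours, one could step to \<open>w\<close>, descend to the root and
  climb back to \<open>u\<close>, staying off the bridge between \<open>x\<close> and
  \<open>u\<close>.\<close>

lemma closer_neighbour_unique:
  assumes r: "r \<in> V" and xu: "(x, u) \<in> E" "gdist r u \<le> gdist r x"
    and xw: "(x, w) \<in> E" "gdist r w \<le> gdist r x"
  shows "u = w"
proof (rule ccontr)
  assume "u \<noteq> w"
  define R where "R = E - {(x, u), (u, x)}"
  have sym: "(b, a) \<in> R" if "(a, b) \<in> R" for a b using that arcs_sym by (auto simp: R_def)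
  have lt: "gdist r u < gdist r x" "gdist r w < gdist r x"
    using gdist_arc_neq[OF r xu(1)] gdist_arc_neq[OF r xw(1)] xu(2) xw(2) by auto
  then have "descending r n \<subseteq> R" if "n < gdist r x" for n
    using that by (auto simp: descending_def R_def)
  then have "(u, r) \<in> R\<^sup>*" "(w, r) \<in> R\<^sup>*"
    using descending_path[OF r] arcs_in[OF xu(1)] arcs_in[OF xw(1)] lt rtrancl_mono by blast+
  then have "(w, u) \<in> R\<^sup>*" using rtrancl_sym_rel[of R, OF sym] by (meson rtrancl_trans)
  moreover have "(x, w) \<in> R" using xw irrefl \<open>u \<noteq> w\<close> by (auto simp: R_def)
  ultimately have "(x, u) \<in> R\<^sup>*" by (rule converse_rtrancl_into_rtrancl[rotated])
  then show False using bridge[OF xu(1)] by (simp add: R_def)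
qed

lemma gdist_arc_cases:
  assumes "r \<in> V" "(x, y) \<in> E"
  obtains "gdist r x = Suc (gdist r y)" | "gdist r y = Suc (gdist r x)"
  using gdist_arc_le[of r x y] gdist_arc_le[of r y x] gdist_arc_neq assms arcs_sym
  by (metis le_SucE le_antisym)

text \<open>Convexity of subtrees, one geodesic step at a time: the step towards \<open>r\<close>
  taken inside the subtree must agree with the one in the whole tree.\<close>

lemma subtree_closer_neighbour:
  assumes S: "rel_tree V' E'" "V' \<subseteq> V" "E' \<subseteq> E"
    and r: "r \<in> V'" and x: "x \<in> V'" and xu: "(x, u) \<in> E" "gdist r x = Suc (gdist r u)"
  shows "(x, u) \<in> E'"
proof -
  interpret S: rel_tree V' E' by fact
  have rV: "r \<in> V" using r S by auto
  \<comment> \<open>The second conjunct serves the case where \<open>w\<close> is farther from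
    \<open>r\<close> than \<open>x\<close> in the whole tree: the induction hypothesis at
    \<open>w\<close> then makes it farther in the subtree too, against the choice of
    \<open>w\<close>.\<close>
  have "(x, u) \<in> E' \<and> S.gdist r x = Suc (S.gdist r u)"
    using x xu
  proof (induction "S.gdist r x" arbitrary: x u rule: less_induct)
    case less
    have "x \<noteq> r" using less.prems by auto
    then obtain w where w: "(x, w) \<in> E'" "S.gdist r x = Suc (S.gdist r w)"
      using S.closer_neighbour r less.prems(1) by blast
    then have xw: "(x, w) \<in> E" and "(w, x) \<in> E" and wV: "w \<in> V'"
      using S arcs_sym S.arcs_in by auto
    show ?case
    proof (cases rule: gdist_arc_cases[OF rV xw])
      case 1
      then have "u = w"
        using closer_neighbour_unique[OF rV less.prems(2) _ xw] less.prems(3) by simp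
      then show ?thesis using w by simp
    next
      case 2
      then have "S.gdist r w = Suc (S.gdist r x)"
        using less.hyps[OF _ wV \<open>(w, x) \<in> E\<close>] w by simp
      then show ?thesis using w by simp
    qed
  qed
  then show ?thesis ..
qed

lemma subtree_arc:
  assumes S: "rel_tree V' E'" "V' \<subseteq> V" "E' \<subseteq> E" and "x \<in> V'" "y \<in> V'" "(x, y) \<in> E"
  shows "(x, y) \<in> E'"
proof -
  interpret S: rel_tree V' E' by fact
  have "x \<in> V" "y \<in> V" using assms by auto
  have "gdist y x = Suc (gdist y y)"
    using gdist_arc_cases[OF \<open>y \<in> V\<close> \<open>(x, y) \<in> E\<close>] by force
  then show ?thesis using subtree_closer_neighbour[OF S, of y x y] assms by simp
qed

text \<open>Rooted at \<open>x\<close>, the vertex \<open>z\<close> is two steps away with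
  \<open>y\<close> on the way. Minimality of blow-ups uses this to recover the centre of a star from
  two of its ends.\<close>

lemma subtree_between:
  assumes S: "rel_tree V' E'" "V' \<subseteq> V" "E' \<subseteq> E" and "x \<in> V'" "z \<in> V'" "x \<noteq> z"
    and "(x, y) \<in> E" "(y, z) \<in> E"
  shows "y \<in> V'"
proof -
  interpret S: rel_tree V' E' by fact
  have xV: "x \<in> V" using assms by auto
  have y: "gdist x y = Suc (gdist x x)"
    using gdist_arc_cases[OF xV \<open>(x, y) \<in> E\<close>] by force
  have "gdist x z = Suc (gdist x y)"
    using gdist_arc_cases[OF xV \<open>(y, z) \<in> E\<close>]
      closer_neighbour_unique[OF xV \<open>(y, z) \<in> E\<close> _ arcs_sym[OF \<open>(x, y) \<in> E\<close>]] \<open>x \<noteq> z\<close> y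
    by (metis le_SucI order_refl)
  then have "(z, y) \<in> E'" using subtree_closer_neighbour[OF S, of x z y] assms arcs_sym by auto
  then show ?thesis using S.arcs_in by blast
qed

lemma connected_subgraph:
  assumes "V' \<noteq> {}" "V' \<subseteq> V" "E' \<subseteq> E" "E' \<subseteq> V' \<times> V'" "\<And>x y. (x, y) \<in> E' \<Longrightarrow> (y, x) \<in> E'"
    and "\<And>x y. x \<in> V' \<Longrightarrow> y \<in> V' \<Longrightarrow> (x, y) \<in> E'\<^sup>*"
  shows "rel_tree V' E'"
proof
  fix x y
  assume "(x, y) \<in> E'"
  moreover have "(E' - {(x, y), (y, x)})\<^sup>* \<subseteq> (E - {(x, y), (y, x)})\<^sup>*"
    using assms(3) by (intro rtrancl_mono) auto
  ultimately show "(x, y) \<notin> (E' - {(x, y), (y, x)})\<^sup>*" using bridge[of x y] assms(3) by blast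
qed (use assms in auto)

end

section \<open>Fixed points of automorphisms of a tree\<close>

locale tree_action = rel_tree V E + group_action G V \<alpha>
  for G (structure) and V :: "'v set" and E and \<alpha> +
  assumes act_arc: "g \<in> carrier G \<Longrightarrow> (x, y) \<in> E \<Longrightarrow> (\<alpha> g x, \<alpha> g y) \<in> E"
begin

lemma group_G: "group G"
  using group_hom group_hom.axioms(1) by auto

lemma act_in: "g \<in> carrier G \<Longrightarrow> x \<in> V \<Longrightarrow> \<alpha> g x \<in> V"
  using element_image by blast

lemma act_mult: "g \<in> carrier G \<Longrightarrow> h \<in> carrier G \<Longrightarrow> x \<in> V \<Longrightarrow> \<alpha> (g \<otimes> h) x = \<alpha> g (\<alpha> h x)"
  using composition_rule by blast

lemma act_one: "x \<in> V \<Longrightarrow> \<alpha> \<one> x = x"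
  using id_eq_one by (metis restrict_apply')

lemma act_inv: "g \<in> carrier G \<Longrightarrow> x \<in> V \<Longrightarrow> \<alpha> (inv g) (\<alpha> g x) = x"
  using orbit_sym_aux by blast

lemma act_inv': "g \<in> carrier G \<Longrightarrow> x \<in> V \<Longrightarrow> \<alpha> g (\<alpha> (inv g) x) = x"
  by (metis act_inv group.inv_closed group.inv_inv group_G)

lemma act_inj: "g \<in> carrier G \<Longrightarrow> x \<in> V \<Longrightarrow> y \<in> V \<Longrightarrow> \<alpha> g x = \<alpha> g y \<Longrightarrow> x = y"
  by (metis act_inv)

lemma gdist_act:
  assumes "g \<in> carrier G" "r \<in> V" "x \<in> V" "\<alpha> g r = r"
  shows "gdist r (\<alpha> g x) = gdist r x"
proof -
  have le: "gdist r (\<alpha> h y) \<le> gdist r y" if "h \<in> carrier G" "y \<in> V" "\<alpha> h r = r" for h y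
    using relpow_map[OF gdist_relpow[OF \<open>r \<in> V\<close> \<open>y \<in> V\<close>], of "\<alpha> h"] act_arc that gdist_le by metis
  have inv: "inv g \<in> carrier G" using assms group.inv_closed group_G by metis
  have "\<alpha> (inv g) r = r" using act_inv[of g r] assms by simp
  then show ?thesis
    using le[of g x] le[of "inv g" "\<alpha> g x"] assms act_inv[of g x] inv act_in by fastforce
qed

text \<open>The translate of \<open>u\<close> is again a neighbour of \<open>x\<close> closer to
  \<open>r\<close>, and there is only one. So an element fixing two vertices fixes the path between
  them.\<close>

lemma fix_closer_neighbour:
  assumes "g \<in> carrier G" "r \<in> V" "(x, u) \<in> E" "gdist r x = Suc (gdist r u)"
    and "\<alpha> g r = r" "\<alpha> g x = x"
  shows "\<alpha> g u = u"
proof -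
  have "(x, \<alpha> g u) \<in> E" using act_arc[OF assms(1,3)] assms by simp
  moreover have "gdist r (\<alpha> g u) = gdist r u" using gdist_act assms arcs_in by blast
  ultimately show ?thesis using closer_neighbour_unique[OF assms(2), of x "\<alpha> g u" u] assms by simp
qed

lemma fixed_arc:
  assumes "x \<in> V" "y \<in> V" "x \<noteq> y"
  obtains u where "(x, u) \<in> E"
    and "\<And>g. g \<in> carrier G \<Longrightarrow> \<alpha> g x = x \<Longrightarrow> \<alpha> g y = y \<Longrightarrow> \<alpha> g u = u"
  using closer_neighbour[OF assms(2,1,3)] fix_closer_neighbour assms by metis

text \<open>An element with a fixed point preserves the distance to it, whereas adjacent vertices
  have different distances. So an element moving a vertex to a neighbour is not elliptic.\<close>

lemma not_translate_adjacent:
  assumes "g \<in> carrier G" "r \<in> V" "\<alpha> g r = r" "(u, \<alpha> g u) \<in> E"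
  shows False
  using gdist_act[of g r u] gdist_arc_neq[of r u "\<alpha> g u"] assms arcs_in by metis

text \<open>The end nearer to \<open>r\<close> lies on the path from \<open>r\<close> to the other
  end. If both end stabilizers fix \<open>r\<close>, one of them therefore contains the
  other.\<close>

lemma common_fixpoint_arc:
  assumes "r \<in> V" "(u, w) \<in> E"
  obtains "\<And>g. g \<in> carrier G \<Longrightarrow> \<alpha> g r = r \<Longrightarrow> \<alpha> g u = u \<Longrightarrow> \<alpha> g w = w"
  | "\<And>g. g \<in> carrier G \<Longrightarrow> \<alpha> g r = r \<Longrightarrow> \<alpha> g w = w \<Longrightarrow> \<alpha> g u = u"
proof (cases rule: gdist_arc_cases[OF assms])
  case 1
  then show ?thesis using that(1) fix_closer_neighbour assms by metis
next
  case 2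
  then show ?thesis using that(2) fix_closer_neighbour assms arcs_sym by metis
qed

end

section \<open>Trees with a group action\<close>

locale G_tree = tree_action +
  assumes no_inversion: "g \<in> carrier G \<Longrightarrow> (x, y) \<in> E \<Longrightarrow> \<alpha> g x = y \<Longrightarrow> \<alpha> g y = x \<Longrightarrow> False"
    and minimal: "rel_tree V' E' \<Longrightarrow> V' \<subseteq> V \<Longrightarrow> E' \<subseteq> E \<Longrightarrow>
      (\<And>g x. g \<in> carrier G \<Longrightarrow> x \<in> V' \<Longrightarrow> \<alpha> g x \<in> V') \<Longrightarrow>
      (\<And>g x y. g \<in> carrier G \<Longrightarrow> (x, y) \<in> E' \<Longrightarrow> (\<alpha> g x, \<alpha> g y) \<in> E') \<Longrightarrow> V' = V \<and> E' = E"

lemma (in tree_action) invariant_image_arcs: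
  assumes "F \<subseteq> E" "\<And>g x y. g \<in> carrier G \<Longrightarrow> (x, y) \<in> F \<Longrightarrow> (\<alpha> g x, \<alpha> g y) \<in> F" "g \<in> carrier G"
  shows "map_prod (\<alpha> g) (\<alpha> g) ` F = F"
proof
  show "map_prod (\<alpha> g) (\<alpha> g) ` F \<subseteq> F" using assms by auto
  have "(x, y) \<in> map_prod (\<alpha> g) (\<alpha> g) ` F" if "(x, y) \<in> F" for x y
  proof
    show "(\<alpha> (inv g) x, \<alpha> (inv g) y) \<in> F" using assms that group.inv_closed[OF group_G] by blast
    show "(x, y) = map_prod (\<alpha> g) (\<alpha> g) (\<alpha> (inv g) x, \<alpha> (inv g) y)"
      using assms that arcs_in[of x y] act_inv' by auto
  qed
  then show "F \<subseteq> map_prod (\<alpha> g) (\<alpha> g) ` F" by auto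
qed

lemma (in tree_action) invariant_image_verts:
  assumes "W \<subseteq> V" "\<And>g x. g \<in> carrier G \<Longrightarrow> x \<in> W \<Longrightarrow> \<alpha> g x \<in> W" "g \<in> carrier G"
  shows "\<alpha> g ` W = W"
proof
  show "\<alpha> g ` W \<subseteq> W" using assms by auto
  have "x = \<alpha> g (\<alpha> (inv g) x) \<and> \<alpha> (inv g) x \<in> W" if "x \<in> W" for x
    using assms that act_inv'[of g x] group.inv_closed[OF group_G] by auto
  then show "W \<subseteq> \<alpha> g ` W" by blast
qed

lemma subgraph_iff:
  assumes "rel_tree (pverts S) (parcs S)" "rel_tree (pverts X) (parcs X)"
  shows "subgraph (with_proj S) (with_proj X) \<longleftrightarrow> pverts S \<subseteq> pverts X \<and> parcs S \<subseteq> parcs X"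
proof -
  have "wf_digraph (with_proj Y)" if "rel_tree (pverts Y) (parcs Y)" for Y :: "'a pair_pre_digraph"
    using rel_tree.arcs_sub[OF that] by unfold_locales auto
  then show ?thesis using assms by (auto simp: subgraph_def compatible_def)
qed

lemma is_G_tree_iff: "is_G_tree G T \<longleftrightarrow> G_tree G (tverts T) (tarcs T) (act T)"
proof
  assume T: "is_G_tree G T"
  then interpret rel_tree "tverts T" "tarcs T" by (simp add: is_G_tree_def simplicial_tree_iff)
  interpret group_action G "tverts T" "act T" using T by (simp add: is_G_tree_def)
  interpret tree_action G "tverts T" "tarcs T" "act T"
  proof
    show "(act T g x, act T g y) \<in> tarcs T" if "g \<in> carrier G" "(x, y) \<in> tarcs T" for g x y
      using T that imageI[of "(x, y)" "tarcs T" "arc_act T g"] by (auto simp: is_G_tree_def arc_act_def)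
  qed
  show "G_tree G (tverts T) (tarcs T) (act T)"
  proof
    fix g x y
    assume "g \<in> carrier G" "(x, y) \<in> tarcs T" "act T g x = y" "act T g y = x"
    then show False using T by (fastforce simp: is_G_tree_def arc_act_def)
  next
    fix V' E'
    assume *: "rel_tree V' E'" "V' \<subseteq> tverts T" "E' \<subseteq> tarcs T"
      "\<And>g x. g \<in> carrier G \<Longrightarrow> x \<in> V' \<Longrightarrow> act T g x \<in> V'"
      "\<And>g x y. g \<in> carrier G \<Longrightarrow> (x, y) \<in> E' \<Longrightarrow> (act T g x, act T g y) \<in> E'"
    define S where "S = \<lparr>pverts = V', parcs = E'\<rparr>"
    have "invariant_subtree G T S"
      using * rel_tree_axioms invariant_image_verts[OF *(2,4)] invariant_image_arcs[OF *(3,5)]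
      by (auto simp: invariant_subtree_def S_def simplicial_tree_iff subgraph_iff arc_act_def)
    then have "S = graph_of T" using T by (auto simp: is_G_tree_def)
    then show "V' = tverts T \<and> E' = tarcs T" by (metis S_def pair_pre_digraph.select_convs)
  qed
next
  assume "G_tree G (tverts T) (tarcs T) (act T)"
  then interpret G_tree G "tverts T" "tarcs T" "act T" .
  have "S = graph_of T" if S: "invariant_subtree G T S" for S
  proof -
    have *: "rel_tree (pverts S) (parcs S)" "pverts S \<subseteq> tverts T" "parcs S \<subseteq> tarcs T"
      using S rel_tree_axioms by (auto simp: invariant_subtree_def simplicial_tree_iff subgraph_iff)
    moreover have "act T g x \<in> pverts S" if "g \<in> carrier G" "x \<in> pverts S" for g x
      using S that by (auto simp: invariant_subtree_def)
    moreover have "(act T g x, act T g y) \<in> parcs S" if "g \<in> carrier G" "(x, y) \<in> parcs S" for g x y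
      using S that by (fastforce simp: invariant_subtree_def arc_act_def)
    ultimately have "pverts S = tverts T \<and> parcs S = tarcs T" by (rule minimal)
    then show ?thesis by (cases S; cases "graph_of T") auto
  qed
  moreover have "arc_act T g ` tarcs T = tarcs T" if "g \<in> carrier G" for g
    unfolding arc_act_def using invariant_image_arcs[of "tarcs T" g] act_arc that by auto
  ultimately show "is_G_tree G T"
    using no_inversion rel_tree_axioms group_action_axioms
    unfolding is_G_tree_def simplicial_tree_iff by (simp add: arc_act_def) (metis swap_simp map_prod_simp prod.collapse prod.inject)
qed

lemma mem_vertex_stab [simp]: "g \<in> vertex_stab G T x \<longleftrightarrow> g \<in> carrier G \<and> act T g x = x"
  by (auto simp: vertex_stab_def stabilizer_def)

lemma mem_edge_stab [simp]:
  "g \<in> edge_stab G T e \<longleftrightarrow> g \<in> carrier G \<and> act T g (fst e) = fst e \<and> act T g (snd e) = snd e"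
  by (cases e) (auto simp: edge_stab_def stabilizer_def arc_act_def)

section \<open>Consequences of minimality: finitely many edge orbits, infinitely many
  vertices\<close>

context G_tree
begin

text \<open>The translates of finitely many arcs joining a vertex to its images under the generators
  form an invariant subtree.\<close>

lemma finite_arc_orbits:
  assumes "finitely_generated_group G"
  obtains F where "finite F" "F \<subseteq> E"
    "\<And>x y. (x, y) \<in> E \<Longrightarrow> \<exists>(a, b)\<in>F. \<exists>g\<in>carrier G. x = \<alpha> g a \<and> y = \<alpha> g b"
proof -
  interpret G: group G by (rule group_G)
  obtain S where S: "finite S" "S \<subseteq> carrier G" "generate G S = carrier G"
    using assms by (auto simp: finitely_generated_group_def)
  obtain v where v: "v \<in> V" using nonempty by blast
  have "\<exists>R. finite R \<and> R \<subseteq> E \<and> (v, \<alpha> s v) \<in> R\<^sup>*" if "s \<in> S" for s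
    using rtrancl_finite_subrel[OF connected[OF v act_in[OF _ v]]] that S(2) by (metis subsetD)
  then obtain R where R: "\<And>s. s \<in> S \<Longrightarrow> finite (R s) \<and> R s \<subseteq> E \<and> (v, \<alpha> s v) \<in> (R s)\<^sup>*"
    by metis
  define F where "F = (\<Union>s\<in>S. R s) \<union> (\<Union>s\<in>S. R s)\<inverse>"
  have F: "finite F" "F \<subseteq> E" using S(1) R arcs_sym by (auto simp: F_def)
  define W where "W = {(\<alpha> g a, \<alpha> g b) |g a b. g \<in> carrier G \<and> (a, b) \<in> F}"
  \<comment> \<open>Connectedness of all the translates is not known yet, so only the component of
    \<open>v\<close> is taken; it is invariant once it contains every translate of
    \<open>v\<close>.\<close>
  define C where "C = {x. (v, x) \<in> W\<^sup>*}"
  define E' where "E' = W \<inter> C \<times> C"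
  have W_E: "W \<subseteq> E" using F act_arc by (auto simp: W_def)
  have W_sym: "(y, x) \<in> W" if "(x, y) \<in> W" for x y
  proof -
    from that obtain g a b where "g \<in> carrier G" "(a, b) \<in> F" "x = \<alpha> g a" "y = \<alpha> g b"
      by (auto simp: W_def)
    moreover from this have "(b, a) \<in> F" by (auto simp: F_def)
    ultimately show ?thesis by (auto simp: W_def)
  qed
  have W_act: "(\<alpha> g x, \<alpha> g y) \<in> W" if g: "g \<in> carrier G" and xy: "(x, y) \<in> W" for g x y
  proof -
    from xy obtain h a b where h: "h \<in> carrier G" "(a, b) \<in> F" "x = \<alpha> h a" "y = \<alpha> h b"
      by (auto simp: W_def)
    then have "\<alpha> g x = \<alpha> (g \<otimes> h) a" "\<alpha> g y = \<alpha> (g \<otimes> h) b"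
      using act_mult[OF g h(1)] arcs_in F by auto
    then show ?thesis using h g by (auto simp: W_def)
  qed
  have W_act_path: "(\<alpha> g x, \<alpha> g y) \<in> W\<^sup>*" if "g \<in> carrier G" "(x, y) \<in> W\<^sup>*" for g x y
    using rtrancl_map[OF that(2), of "\<alpha> g"] W_act[OF that(1)] by blast
  have F_W: "F \<subseteq> W"
  proof
    fix e assume "e \<in> F"
    then have "e = (\<alpha> \<one> (fst e), \<alpha> \<one> (snd e))" using act_one F arcs_sub by (cases e) auto
    then show "e \<in> W" using \<open>e \<in> F\<close> unfolding W_def by (metis (mono_tags, lifting) G.one_closed mem_Collect_eq prod.collapse)
  qed
  \<comment> \<open>Induction on words in the generators: a path for \<open>h\<close> is continued
    by the \<open>h\<close>-translate of a path for \<open>k\<close>.\<close>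
  have orbit_C: "(v, \<alpha> g v) \<in> W\<^sup>*" if "g \<in> generate G S" for g
    using that
  proof induction
    case one
    then show ?case using act_one v by simp
  next
    case (incl h)
    then have "R h \<subseteq> W" using F_W by (auto simp: F_def)
    then show ?case using R[OF incl] rtrancl_mono by blast
  next
    case (inv h)
    then have "R h \<subseteq> W" using F_W by (auto simp: F_def)
    then have "(v, \<alpha> h v) \<in> W\<^sup>*" using R[OF inv] rtrancl_mono by blast
    then have "(\<alpha> (inv h) v, v) \<in> W\<^sup>*"
      using W_act_path[of "inv h" v "\<alpha> h v"] act_inv[of h v] S(2) inv v by auto
    then show ?case using rtrancl_sym_rel[of W, OF W_sym] by blast
  next
    case (eng h k)
    then have "h \<in> carrier G" "k \<in> carrier G" using S(3) by auto
    then have "(\<alpha> h v, \<alpha> (h \<otimes> k) v) \<in> W\<^sup>*"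
      using W_act_path[of h v "\<alpha> k v"] act_mult v eng by simp
    then show ?case using eng by (meson rtrancl_trans)
  qed
  have C_V: "C \<subseteq> V"
    using rtrancl_invariant[of v _ W V] v W_E arcs_in unfolding C_def by blast
  have C_path: "(v, x) \<in> E'\<^sup>*" if "x \<in> C" for x
    using that unfolding C_def mem_Collect_eq
  proof induction
    case (step y z)
    then have "(y, z) \<in> E'" by (auto simp: E'_def C_def intro: rtrancl_into_rtrancl)
    then show ?case using step.IH by (rule rtrancl_into_rtrancl[rotated])
  qed simp
  have E'_sym: "(y, x) \<in> E'" if "(x, y) \<in> E'" for x y using that W_sym by (auto simp: E'_def)
  have C_act: "\<alpha> g x \<in> C" if "g \<in> carrier G" "x \<in> C" for g x
    using W_act_path[of g v x] orbit_C[of g] that S(3) by (auto simp: C_def)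
  have "rel_tree C E'"
  proof (rule connected_subgraph)
    show "(x, y) \<in> E'\<^sup>*" if "x \<in> C" "y \<in> C" for x y
      using C_path[OF that(2)] rtrancl_sym_rel[of E', OF E'_sym C_path[OF that(1)]]
      by (rule rtrancl_trans[rotated])
    show "C \<noteq> {}" by (auto simp: C_def)
    show "(y, x) \<in> E'" if "(x, y) \<in> E'" for x y using that by (rule E'_sym)
  qed (use C_V W_E in \<open>auto simp: E'_def\<close>)
  moreover have "E' \<subseteq> E" "E' \<subseteq> W" using W_E by (auto simp: E'_def)
  moreover have "(\<alpha> g x, \<alpha> g y) \<in> E'" if "g \<in> carrier G" "(x, y) \<in> E'" for g x y
    using that C_act W_act by (simp add: E'_def)
  ultimately have "E \<subseteq> W" using minimal[of C E', OF _ C_V] C_act by metis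
  show thesis
  proof (rule that[OF F])
    fix x y assume "(x, y) \<in> E"
    then show "\<exists>(a, b)\<in>F. \<exists>g\<in>carrier G. x = \<alpha> g a \<and> y = \<alpha> g b"
      using \<open>E \<subseteq> W\<close> unfolding W_def by blast
  qed
qed

text \<open>In a finite tree the vertices farthest from \<open>v\<close> are leaves; deleting the orbit of
  one of them contradicts minimality.\<close>

lemma infinite_verts:
  assumes v: "(v, a) \<in> E" "(v, b) \<in> E" "a \<noteq> b"
  shows "infinite V"
proof
  assume fin: "finite V"
  interpret G: group G by (rule group_G)
  have vV: "v \<in> V" using v arcs_in by blast
  then have ne: "gdist v ` V \<noteq> {}" by blast
  obtain x where x: "x \<in> V" "\<And>y. y \<in> V \<Longrightarrow> gdist v y \<le> gdist v x"
    using Max_in[OF finite_imageI[OF fin] ne] Max_ge[OF finite_imageI[OF fin]]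
    by (metis (no_types, lifting) imageE imageI)
  define orb where "orb = {\<alpha> g x |g. g \<in> carrier G}"
  have x_leaf: "y = z" if "(x, y) \<in> E" "(x, z) \<in> E" for y z
    using closer_neighbour_unique[OF vV that(1) _ that(2)] x(2) that arcs_in by blast
  have O_leaf: "y = z" if o: "o' \<in> orb" "(o', y) \<in> E" "(o', z) \<in> E" for o' y z
  proof -
    obtain g where g: "g \<in> carrier G" "o' = \<alpha> g x" using o(1) by (auto simp: orb_def)
    then have "\<alpha> (inv g) y = \<alpha> (inv g) z"
      using x_leaf[of "\<alpha> (inv g) y" "\<alpha> (inv g) z"] act_arc[OF G.inv_closed[OF g(1)] o(2)]
        act_arc[OF G.inv_closed[OF g(1)] o(3)] act_inv[OF g(1) x(1)] by simp
    then show ?thesis using act_inj[OF G.inv_closed[OF g(1)]] o arcs_in by blast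
  qed
  define V' where "V' = V - orb"
  define E' where "E' = E \<inter> V' \<times> V'"
  \<comment> \<open>Having two neighbours, \<open>v\<close> is not in the orbit of a leaf; it
    survives the deletion and serves as the root.\<close>
  have vV': "v \<in> V'" using O_leaf[OF _ v(1,2)] v(3) vV by (auto simp: V'_def)
  have E'_sym: "(z, y) \<in> E'" if "(y, z) \<in> E'" for y z using that arcs_sym by (auto simp: E'_def)
  have path: "(y, v) \<in> E'\<^sup>*" if "y \<in> V'" for y
    using that
  proof (induction "gdist v y" arbitrary: y rule: less_induct)
    case less
    show ?case
    proof (cases "y = v")
      case False
      obtain u where u: "(y, u) \<in> E" "gdist v y = Suc (gdist v u)"
        using closer_neighbour[OF vV, of y] False less.prems by (auto simp: V'_def)
      \<comment> \<open>A descent never passes through a leaf: the neighbours before and after it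
        would coincide, although they lie at different levels.\<close>
      have "u \<in> V'"
      proof (rule ccontr)
        assume "u \<notin> V'"
        then have "u \<in> orb" "u \<noteq> v" "u \<in> V" using vV' u arcs_in by (auto simp: V'_def)
        then obtain w where "(u, w) \<in> E" "gdist v u = Suc (gdist v w)"
          using closer_neighbour[OF vV, of u] by blast
        then show False using O_leaf[OF \<open>u \<in> orb\<close>, of w y] u arcs_sym by auto
      qed
      then have "(y, u) \<in> E'" using u less.prems by (auto simp: E'_def)
      moreover have "(u, v) \<in> E'\<^sup>*" using less.hyps \<open>u \<in> V'\<close> u by simp
      ultimately show ?thesis by (rule converse_rtrancl_into_rtrancl)
    qed simp
  qed
  have act_V': "\<alpha> g y \<in> V'" if g: "g \<in> carrier G" "y \<in> V'" for g y
  proof (rule ccontr)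
    assume "\<alpha> g y \<notin> V'"
    then obtain h where h: "h \<in> carrier G" "\<alpha> g y = \<alpha> h x"
      using g act_in[of g y] by (auto simp: V'_def orb_def)
    then have "y = \<alpha> (inv g \<otimes> h) x"
      using act_mult[of "inv g" h x] act_inv[of g y] g x by (simp add: V'_def)
    then have "y \<in> orb" using g h by (auto simp: orb_def)
    then show False using g by (simp add: V'_def)
  qed
  have "rel_tree V' E'"
  proof (rule connected_subgraph)
    show "(y, z) \<in> E'\<^sup>*" if "y \<in> V'" "z \<in> V'" for y z
      using path[OF that(1)] rtrancl_sym_rel[of E', OF E'_sym path[OF that(2)]]
      by (rule rtrancl_trans)
    show "V' \<noteq> {}" using vV' by blast
    show "(z, y) \<in> E'" if "(y, z) \<in> E'" for y z using that by (rule E'_sym)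
  qed (auto simp: E'_def V'_def)
  moreover have "V' \<subseteq> V" "E' \<subseteq> E" by (auto simp: E'_def V'_def)
  moreover have "(\<alpha> g y, \<alpha> g z) \<in> E'" if "g \<in> carrier G" "(y, z) \<in> E'" for g y z
    using that act_V' act_arc by (simp add: E'_def)
  ultimately have "V' = V" using minimal[of V' E'] act_V' by metis
  moreover have "x \<in> orb" using act_one[OF x(1)] G.one_closed unfolding orb_def by (metis (mono_tags, lifting) mem_Collect_eq)
  ultimately show False using x by (auto simp: V'_def)
qed

end

section \<open>Elliptic and bi-elliptic subgroups across a deformation space\<close>

lemma (in tree_action) subgroup_fixpoint: "x \<in> V \<Longrightarrow> subgroup {g \<in> carrier G. \<alpha> g x = x} G"
  using stabilizer_subgroup[of x] by (simp add: stabilizer_def)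

lemma elliptic_vertex_stab:
  assumes "is_G_tree G T" "x \<in> tverts T"
  shows "elliptic G T (vertex_stab G T x)"
proof -
  interpret G_tree G "tverts T" "tarcs T" "act T" using assms by (simp add: is_G_tree_iff)
  show ?thesis using subgroup_fixpoint[OF assms(2)] assms(2)
    by (auto simp: elliptic_def vertex_stab_def stabilizer_def)
qed

text \<open>The arc is the first one on the path from \<open>x\<close> to \<open>y\<close>. That it
  starts at \<open>x\<close> is what later yields edges adjacent to \<open>v\<close>.\<close>

lemma bi_elliptic_fix_two:
  assumes "is_G_tree G T" "subgroup H G" "x \<in> tverts T" "y \<in> tverts T" "x \<noteq> y"
    and "\<And>h. h \<in> H \<Longrightarrow> act T h x = x" "\<And>h. h \<in> H \<Longrightarrow> act T h y = y"
  obtains u where "(x, u) \<in> tarcs T" "H \<subseteq> edge_stab G T (x, u)"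
proof -
  interpret G_tree G "tverts T" "tarcs T" "act T" using assms by (simp add: is_G_tree_iff)
  obtain u where "(x, u) \<in> tarcs T"
    "\<And>g. g \<in> carrier G \<Longrightarrow> act T g x = x \<Longrightarrow> act T g y = y \<Longrightarrow> act T g u = u"
    using fixed_arc[OF assms(3-5)] by blast
  moreover from this have "H \<subseteq> edge_stab G T (x, u)"
    using assms subgroup.subset[OF assms(2)] by auto
  ultimately show thesis using that by blast
qed

text \<open>Reducedness provides \<open>g\<close> with \<open>w = g u\<close>. It moves
  \<open>u\<close> to a neighbour, so it has no fixed point in \<open>R\<close>, and none in
  \<open>T\<close> because the elliptic subgroups agree. Hence \<open>x\<close> and
  \<open>g x\<close> are distinct, and the group fixes both.\<close>

lemma reduced_bi_elliptic_vertex_stab: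
  fixes G (structure)
  assumes R: "is_G_tree G R" "reduced G R" and T: "is_G_tree G T"
    and ell: "\<And>H. elliptic G R H \<longleftrightarrow> elliptic G T H"
    and uw: "(u, w) \<in> tarcs R" "vertex_stab G R u \<subseteq> vertex_stab G R w"
  shows "bi_elliptic G T (vertex_stab G R u)"
proof -
  interpret R: G_tree G "tverts R" "tarcs R" "act R" using R by (simp add: is_G_tree_iff)
  interpret T: G_tree G "tverts T" "tarcs T" "act T" using T by (simp add: is_G_tree_iff)
  interpret group G by (rule R.group_G)
  have uV: "u \<in> tverts R" using uw R.arcs_in by blast
  have "edge_stab G R (u, w) = vertex_stab G R u" using uw(2) by auto
  then have "w \<in> orbit G (act R) u" using R(2) uw(1) by (auto simp: reduced_def)
  then obtain g where g: "g \<in> carrier G" "w = act R g u" by (auto simp: orbit_def)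
  have stab: "elliptic G T (vertex_stab G R u)" using ell elliptic_vertex_stab[OF R(1) uV] by blast
  then obtain x where x: "x \<in> tverts T" "\<And>h. h \<in> vertex_stab G R u \<Longrightarrow> act T h x = x"
    unfolding elliptic_def by blast
  have sub: "subgroup (vertex_stab G R u) G" using stab by (simp add: elliptic_def)
  \<comment> \<open>The stabilizer of \<open>u\<close> also fixes \<open>g u\<close>, so conjugating
    its elements by the inverse of \<open>g\<close> keeps them in it.\<close>
  have fix_gx: "act T h (act T g x) = act T g x" if h: "h \<in> vertex_stab G R u" for h
  proof -
    have hc: "h \<in> carrier G" "act R h (act R g u) = act R g u" using h uw(2) g by auto
    then have "act R (inv g \<otimes> (h \<otimes> g)) u = u"
      using g uV R.act_mult[of h g u] R.act_mult[of "inv g" "h \<otimes> g" u] R.act_inv[of g u] by simp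
    then have "act T (inv g \<otimes> (h \<otimes> g)) x = x" using x(2) hc g by simp
    then have "act T g (act T (inv g \<otimes> (h \<otimes> g)) x) = act T g x" by simp
    then show ?thesis
      using g hc x(1) T.act_mult[of g "inv g \<otimes> (h \<otimes> g)" x] T.act_mult[of h g x]
      by (simp add: m_assoc[symmetric])
  qed
  have "x \<noteq> act T g x"
  proof
    assume "x = act T g x"
    then have "g \<in> vertex_stab G T x" using g by simp
    moreover have "elliptic G R (vertex_stab G T x)"
      using ell elliptic_vertex_stab[OF T x(1)] by blast
    then obtain r where "r \<in> tverts R" "\<And>h. h \<in> vertex_stab G T x \<Longrightarrow> act R h r = r"
      unfolding elliptic_def by blast
    ultimately show False using R.not_translate_adjacent[of g r u] g uw by auto
  qed
  then obtain a where "(x, a) \<in> tarcs T" "vertex_stab G R u \<subseteq> edge_stab G T (x, a)"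
    using bi_elliptic_fix_two[OF T sub x(1) T.act_in[OF g(1) x(1)]] x(2) fix_gx by metis
  then show ?thesis using sub by (auto simp: bi_elliptic_def)
qed

lemma bi_elliptic_mono:
  "bi_elliptic G T K \<Longrightarrow> subgroup H G \<Longrightarrow> H \<subseteq> K \<Longrightarrow> bi_elliptic G T H"
  by (fastforce simp: bi_elliptic_def)

lemma reduced_bi_elliptic:
  assumes R: "is_G_tree G R" "reduced G R" and T: "is_G_tree G T"
    and ell: "\<And>H. elliptic G R H \<longleftrightarrow> elliptic G T H"
    and H: "bi_elliptic G R H"
  shows "bi_elliptic G T H"
proof -
  interpret R: G_tree G "tverts R" "tarcs R" "act R" using R by (simp add: is_G_tree_iff)
  obtain u w where uw: "(u, w) \<in> tarcs R" "H \<subseteq> edge_stab G R (u, w)" and sub: "subgroup H G"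
    using H by (auto simp: bi_elliptic_def)
  have wu: "(w, u) \<in> tarcs R" using uw R.arcs_sym by blast
  have V: "u \<in> tverts R" "w \<in> tverts R" using uw R.arcs_in by auto
  have fixed: "\<exists>x\<in>tverts T. \<forall>h\<in>vertex_stab G R z. act T h x = x" if "z \<in> tverts R" for z
    using ell[of "vertex_stab G R z"] elliptic_vertex_stab[OF R(1) that] unfolding elliptic_def by blast
  obtain x where x: "x \<in> tverts T" "\<And>h. h \<in> vertex_stab G R u \<Longrightarrow> act T h x = x"
    using fixed V by blast
  obtain y where y: "y \<in> tverts T" "\<And>h. h \<in> vertex_stab G R w \<Longrightarrow> act T h y = y"
    using fixed V by blast
  have Hu: "H \<subseteq> vertex_stab G R u" and Hw: "H \<subseteq> vertex_stab G R w" using uw by auto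
  show ?thesis
  proof (cases "x = y")
    case False
    then show ?thesis
      using bi_elliptic_fix_two[OF T sub x(1) y(1)] x(2) y(2) Hu Hw sub
      by (metis bi_elliptic_def subsetD)
  next
    case True
    \<comment> \<open>Both end stabilizers lie in the stabilizer of \<open>x\<close> in
      \<open>T\<close>, which in turn fixes a vertex \<open>r\<close> of \<open>R\<close>. The end
      nearer to \<open>r\<close> then has the larger stabilizer.\<close>
    have "elliptic G R (vertex_stab G T x)"
      using ell elliptic_vertex_stab[OF T x(1)] by blast
    then obtain r where r: "r \<in> tverts R" "\<And>h. h \<in> vertex_stab G T x \<Longrightarrow> act R h r = r"
      unfolding elliptic_def by blast
    have fr: "act R h r = r" if "h \<in> vertex_stab G R u \<or> h \<in> vertex_stab G R w" for h
      using r(2)[of h] x(2)[of h] y(2)[of h] that True by auto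
    have "vertex_stab G R u \<subseteq> vertex_stab G R w \<or> vertex_stab G R w \<subseteq> vertex_stab G R u"
      by (cases rule: R.common_fixpoint_arc[OF r(1) uw(1)]) (use fr in auto)
    then show ?thesis
      using reduced_bi_elliptic_vertex_stab[OF R T ell uw(1)]
        reduced_bi_elliptic_vertex_stab[OF R T ell wu] bi_elliptic_mono sub Hu Hw by metis
  qed
qed

section \<open>Blow-ups of trees\<close>

text \<open>
  A blow-up replaces each vertex \<open>x\<close> of a tree by a star with centre \<open>c x\<close>, whose vertices
  are the points of \<open>W\<close> over \<open>x\<close>, and reattaches each arc \<open>(x, y)\<close> at the point \<open>att x y\<close>
  of the star over \<open>x\<close>.
\<close>

locale blowup = G_tree G V E \<alpha>
  for G (structure) and V :: "'v set" and E and \<alpha> :: "'g \<Rightarrow> 'v \<Rightarrow> 'v" +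
  fixes W :: "'w set" and c :: "'v \<Rightarrow> 'w" and pr :: "'w \<Rightarrow> 'v"
    and att :: "'v \<Rightarrow> 'v \<Rightarrow> 'w" and \<beta> :: "'g \<Rightarrow> 'w \<Rightarrow> 'w"
  assumes action: "group_action G W \<beta>"
    and c_in: "x \<in> V \<Longrightarrow> c x \<in> W" and pr_in: "w \<in> W \<Longrightarrow> pr w \<in> V"
    and att_in: "(x, y) \<in> E \<Longrightarrow> att x y \<in> W"
    and pr_c: "x \<in> V \<Longrightarrow> pr (c x) = x" and pr_att: "(x, y) \<in> E \<Longrightarrow> pr (att x y) = x"
    and c_act: "g \<in> carrier G \<Longrightarrow> x \<in> V \<Longrightarrow> \<beta> g (c x) = c (\<alpha> g x)"
    and pr_act: "g \<in> carrier G \<Longrightarrow> w \<in> W \<Longrightarrow> pr (\<beta> g w) = \<alpha> g (pr w)"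
    and att_act: "g \<in> carrier G \<Longrightarrow> (x, y) \<in> E \<Longrightarrow> \<beta> g (att x y) = att (\<alpha> g x) (\<alpha> g y)"
    and noncentral: "w \<in> W \<Longrightarrow> w \<noteq> c (pr w) \<Longrightarrow> \<exists>y. (pr w, y) \<in> E \<and> att (pr w) y = w"
    and central: "x \<in> V \<Longrightarrow> (\<exists>y. (x, y) \<in> E \<and> att x y = c x) \<or>
      (\<exists>w\<in>W. \<exists>w'\<in>W. pr w = x \<and> pr w' = x \<and> w \<noteq> w' \<and> w \<noteq> c x \<and> w' \<noteq> c x)"
begin

interpretation B: group_action G W \<beta> by (rule action)

inductive_set barcs :: "'w rel" where
  lift: "(x, y) \<in> E \<Longrightarrow> (att x y, att y x) \<in> barcs"
| ray: "w \<in> W \<Longrightarrow> w \<noteq> c (pr w) \<Longrightarrow> (c (pr w), w) \<in> barcs"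
| ray': "w \<in> W \<Longrightarrow> w \<noteq> c (pr w) \<Longrightarrow> (w, c (pr w)) \<in> barcs"

lemma barcs_sym: "(a, b) \<in> barcs \<Longrightarrow> (b, a) \<in> barcs"
  by (erule barcs.cases) (auto intro: barcs.intros dest: arcs_sym)

lemma barcs_sub: "barcs \<subseteq> W \<times> W"
proof -
  have "a \<in> W \<and> b \<in> W" if "(a, b) \<in> barcs" for a b
    using that by cases (auto intro: att_in c_in pr_in arcs_sym)
  then show ?thesis by auto
qed

lemma path_to_centre: "w \<in> W \<Longrightarrow> (w, c (pr w)) \<in> barcs\<^sup>*"
  by (cases "w = c (pr w)") (auto intro: ray')

lemma path_from_centre: "w \<in> W \<Longrightarrow> (c (pr w), w) \<in> barcs\<^sup>*"
  by (cases "w = c (pr w)") (auto intro: ray)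

lemma barcs_connected:
  assumes "w \<in> W" "w' \<in> W"
  shows "(w, w') \<in> barcs\<^sup>*"
proof -
  have "(c x, c y) \<in> barcs\<^sup>*" if "(x, y) \<in> E" for x y
  proof -
    have yx: "(y, x) \<in> E" using that arcs_sym by blast
    have "(c x, att x y) \<in> barcs\<^sup>*" "(att y x, c y) \<in> barcs\<^sup>*"
      using path_from_centre[OF att_in[OF that]] path_to_centre[OF att_in[OF yx]]
        pr_att[OF that] pr_att[OF yx] by auto
    moreover have "(att x y, att y x) \<in> barcs\<^sup>*" using lift[OF that] by blast
    ultimately show ?thesis by (meson rtrancl_trans)
  qed
  then have "(c (pr w), c (pr w')) \<in> barcs\<^sup>*"
    using rtrancl_map[OF connected[OF pr_in[OF assms(1)] pr_in[OF assms(2)]]] by blast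
  then show ?thesis
    using path_to_centre[OF assms(1)] path_from_centre[OF assms(2)] by (meson rtrancl_trans)
qed

text \<open>Collapsing the stars turns a detour into a walk in the original tree that avoids the
  edge between \<open>x\<close> and \<open>y\<close>: rays become constant, and only the removed
  lifts lie over that edge.\<close>

lemma lift_bridge:
  assumes "(x, y) \<in> E"
  shows "(att x y, att y x) \<notin> (barcs - {(att x y, att y x), (att y x, att x y)})\<^sup>*"
proof
  let ?R = "barcs - {(att x y, att y x), (att y x, att x y)}"
  let ?Q = "E - {(x, y), (y, x)}"
  assume *: "(att x y, att y x) \<in> ?R\<^sup>*"
  have "(pr a, pr b) \<in> ?Q\<^sup>*" if "(a, b) \<in> ?R" for a b
  proof -
    have "(a, b) \<in> barcs" using that by blast
    then show ?thesis
    proof cases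
      case (lift p q)
      then have "(p, q) \<in> ?Q" using that by auto
      then show ?thesis using lift pr_att arcs_sym by (metis r_into_rtrancl)
    qed (auto simp: pr_c pr_in)
  qed
  from rtrancl_map[OF *, of pr, OF this] have "(x, y) \<in> ?Q\<^sup>*"
    using pr_att assms arcs_sym by simp
  then show False using bridge[OF assms] by blast
qed

text \<open>The component of \<open>w\<close> without its ray consists of \<open>w\<close> and the points lying over the far side
  of an arc attached at \<open>w\<close>.\<close>

lemma ray_bridge:
  assumes w: "w \<in> W" "w \<noteq> c (pr w)"
  shows "(w, c (pr w)) \<notin> (barcs - {(w, c (pr w)), (c (pr w), w)})\<^sup>*"
proof
  let ?R = "barcs - {(w, c (pr w)), (c (pr w), w)}"
  define x where "x = pr w"
  define Q where "Q = (\<lambda>y. E - {(x, y), (y, x)})"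
  define D where "D = insert w {z. \<exists>y. (x, y) \<in> E \<and> att x y = w \<and> (y, pr z) \<in> (Q y)\<^sup>*}"
  assume *: "(w, c (pr w)) \<in> ?R\<^sup>*"
  have br: "(y, x) \<notin> (Q y)\<^sup>*" if "(x, y) \<in> E" for y
    using bridge[of y x] arcs_sym that by (simp add: Q_def insert_commute)
  have "b \<in> D" if ab: "(a, b) \<in> ?R" and a: "a \<in> D" for a b
  proof -
    have "(a, b) \<in> barcs" using ab by blast
    then show ?thesis
    proof cases
      case (lift p q)
      have prs: "pr a = p" "pr b = q" using lift pr_att arcs_sym by auto
      show ?thesis
      proof (cases "a = w")
        case True
        then have "p = x" using prs by (simp add: x_def)
        then have "(x, q) \<in> E \<and> att x q = w \<and> (q, pr b) \<in> (Q q)\<^sup>*" using True lift prs by simp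
        then show ?thesis by (auto simp: D_def)
      next
        case False
        then obtain y where y: "(x, y) \<in> E" "att x y = w" "(y, p) \<in> (Q y)\<^sup>*"
          using a prs by (auto simp: D_def)
        \<comment> \<open>The first case would put \<open>x\<close> on the far side, against the
          bridge property; the second leads back to \<open>w\<close>; the third stays on the far
          side.\<close>
        consider "(p, q) = (x, y)" | "(p, q) = (y, x)" | "(p, q) \<in> Q y"
          using lift by (auto simp: Q_def)
        then show ?thesis
        proof cases
          case 1 then show ?thesis using y br by simp
        next
          case 2 then show ?thesis using y lift by (simp add: D_def)
        next
          case 3
          then have "(y, pr b) \<in> (Q y)\<^sup>*" using y prs by (auto intro: rtrancl_into_rtrancl)
          then show ?thesis using y by (auto simp: D_def)
        qed
      qed
    next
      case ray
      then have "pr a = pr b" "a \<noteq> w" using pr_c[OF pr_in] w by auto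
      then show ?thesis using a by (auto simp: D_def)
    next
      case ray'
      then have "pr a = pr b" "a \<noteq> w" using pr_c[OF pr_in] ab by auto
      then show ?thesis using a by (auto simp: D_def)
    qed
  qed
  from rtrancl_invariant[OF *, of D, OF _ this] have "c (pr w) \<in> D" by (auto simp: D_def)
  then show False using w br pr_c[OF pr_in[OF w(1)]] by (auto simp: D_def x_def)
qed

sublocale B: tree_action G W barcs \<beta>
proof
  show "W \<noteq> {}" using nonempty c_in by blast
  show "(a, b) \<notin> (barcs - {(a, b), (b, a)})\<^sup>*" if "(a, b) \<in> barcs" for a b
    using that
  proof cases
    case lift then show ?thesis using lift_bridge by blast
  next
    case ray
    let ?R = "barcs - {(b, a), (a, b)}"
    have "(p, q) \<in> ?R" if "(q, p) \<in> ?R" for p q using that barcs_sym by blast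
    from rtrancl_sym_rel[of ?R, OF this] show ?thesis
      using ray_bridge[of b] ray by (auto simp: insert_commute)
  next
    case ray' then show ?thesis using ray_bridge by blast
  qed
  show "(\<beta> g a, \<beta> g b) \<in> barcs" if g: "g \<in> carrier G" and ab: "(a, b) \<in> barcs" for g a b
  proof -
    have star: "\<beta> g w \<in> W" "\<beta> g (c (pr w)) = c (pr (\<beta> g w))" "\<beta> g w \<noteq> c (pr (\<beta> g w))"
      if "w \<in> W" "w \<noteq> c (pr w)" for w
    proof -
      show "\<beta> g w \<in> W" using B.element_image g that by blast
      show *: "\<beta> g (c (pr w)) = c (pr (\<beta> g w))" using c_act pr_act pr_in g that by simp
      show "\<beta> g w \<noteq> c (pr (\<beta> g w))"
        using B.inj_prop[OF g] that c_in[OF pr_in[OF that(1)]] unfolding *[symmetric]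
        by (auto dest: inj_onD)
    qed
    from ab show ?thesis
    proof cases
      case lift
      then show ?thesis using att_act[OF g] arcs_sym act_arc[OF g] by (auto intro: barcs.lift)
    next
      case ray then show ?thesis using star[of b] barcs.ray[of "\<beta> g b"] by simp
    next
      case ray' then show ?thesis using star[of a] barcs.ray'[of "\<beta> g a"] by simp
    qed
  qed
qed (use barcs_sub barcs_sym barcs_connected in auto)

text \<open>The arcs whose lifts lie in the subtree form an invariant subtree of the original tree,
  hence are all arcs. So every attaching point is present. By \<open>noncentral\<close> this covers
  all points other than centres, and by \<open>central\<close> each centre is an attaching point
  itself or lies between two points already present.\<close>

lemma invariant_subtree_blowup:
  assumes S: "rel_tree V' E'" "V' \<subseteq> W" "E' \<subseteq> barcs"
    and inv: "\<And>g x. g \<in> carrier G \<Longrightarrow> x \<in> V' \<Longrightarrow> \<beta> g x \<in> V'"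
      "\<And>g x y. g \<in> carrier G \<Longrightarrow> (x, y) \<in> E' \<Longrightarrow> (\<beta> g x, \<beta> g y) \<in> E'"
  shows "V' = W \<and> E' = barcs"
proof -
  interpret S: rel_tree V' E' by fact
  define E0 where "E0 = {(x, y) \<in> E. (att x y, att y x) \<in> E'}"
  have E0: "E0 \<subseteq> E" by (auto simp: E0_def)
  have E0_V: "x \<in> pr ` V' \<and> y \<in> pr ` V'" if "(x, y) \<in> E0" for x y
  proof -
    have "(x, y) \<in> E" "(y, x) \<in> E" "att x y \<in> V'" "att y x \<in> V'"
      using that arcs_sym S.arcs_in by (auto simp: E0_def)
    then show ?thesis using pr_att by (metis image_eqI)
  qed
  have "(pr a, pr b) \<in> E0\<^sup>*" if "(a, b) \<in> E'" for a b
  proof -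
    have "(a, b) \<in> barcs" using that S by blast
    then show ?thesis
    proof cases
      case (lift x y)
      then have "(x, y) \<in> E0" using that by (simp add: E0_def)
      then show ?thesis using lift pr_att arcs_sym by (metis r_into_rtrancl)
    qed (auto simp: pr_c pr_in)
  qed
  then have conn: "(pr a, pr b) \<in> E0\<^sup>*" if "a \<in> V'" "b \<in> V'" for a b
    using rtrancl_map[OF S.connected[OF that]] by blast
  have "rel_tree (pr ` V') E0"
  proof (rule connected_subgraph)
    show "(y, x) \<in> E0" if "(x, y) \<in> E0" for x y
      using that arcs_sym S.arcs_sym by (auto simp: E0_def)
  qed (use S.nonempty S pr_in E0 E0_V conn in auto)
  moreover have "pr ` V' \<subseteq> V" using pr_in S by blast
  moreover have "\<alpha> g x \<in> pr ` V'" if g: "g \<in> carrier G" and x: "x \<in> pr ` V'" for g x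
  proof -
    obtain w where w: "w \<in> V'" "x = pr w" using x by blast
    then have "\<alpha> g x = pr (\<beta> g w)" using pr_act[OF g] S(2) by auto
    then show ?thesis using inv(1)[OF g w(1)] by blast
  qed
  moreover have "(\<alpha> g x, \<alpha> g y) \<in> E0" if g: "g \<in> carrier G" and xy: "(x, y) \<in> E0" for g x y
  proof -
    have xy': "(x, y) \<in> E" "(y, x) \<in> E" "(att x y, att y x) \<in> E'" using xy arcs_sym by (auto simp: E0_def)
    then show ?thesis using inv(2)[OF g xy'(3)] act_arc[OF g] att_act[OF g] by (simp add: E0_def)
  qed
  ultimately have "E0 = E" using minimal[of "pr ` V'" E0] E0 by metis
  then have att_V': "att x y \<in> V'" if "(x, y) \<in> E" for x y
    using that S.arcs_in unfolding E0_def by blast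
  then have nc: "w \<in> V'" if "w \<in> W" "w \<noteq> c (pr w)" for w using noncentral[OF that] by metis
  have "c x \<in> V'" if x: "x \<in> V" for x
    using central[OF x]
  proof (elim disjE bexE conjE exE)
    fix y assume "(x, y) \<in> E" "att x y = c x"
    then show ?thesis using att_V' by metis
  next
    fix w w' assume w: "w \<in> W" "w' \<in> W" "pr w = x" "pr w' = x" "w \<noteq> w'" "w \<noteq> c x" "w' \<noteq> c x"
    then have "(w, c x) \<in> barcs" "(c x, w') \<in> barcs" using ray'[of w] ray[of w'] by auto
    then show ?thesis using B.subtree_between[OF S, of w w' "c x"] nc w by auto
  qed
  then have "w \<in> V'" if "w \<in> W" for w
    using nc[OF that] pr_in[OF that] by (cases "w = c (pr w)") metis+
  then have "V' = W" using S(2) by blast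
  moreover have "barcs \<subseteq> E'"
    using B.subtree_arc[OF S] \<open>V' = W\<close> barcs_sub by auto
  ultimately show ?thesis using S by blast
qed

lemma blowup_G_tree: "G_tree G W barcs \<beta>"
proof
  fix g a b
  assume g: "g \<in> carrier G" and ab: "(a, b) \<in> barcs" and inv: "\<beta> g a = b" "\<beta> g b = a"
  \<comment> \<open>Centres are sent to centres, so a ray cannot be inverted; an inverted lift would
    project to an inverted arc.\<close>
  have central_eq: "w = c (pr w)" if "w \<in> W" "\<beta> g (c x) = w" "x \<in> V" for w x
    using c_act[OF g \<open>x \<in> V\<close>] pr_c act_in[OF g \<open>x \<in> V\<close>] that by metis
  from ab show False
  proof cases
    case (lift x y)
    then have "\<alpha> g x = y" "\<alpha> g y = x"
      using inv pr_act[OF g, of a] pr_act[OF g, of b] pr_att att_in arcs_sym by metis+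
    then show ?thesis using no_inversion g lift by blast
  qed (use inv central_eq pr_in in blast)+
next
  fix V' E'
  assume "rel_tree V' E'" "V' \<subseteq> W" "E' \<subseteq> barcs"
    "\<And>g x. g \<in> carrier G \<Longrightarrow> x \<in> V' \<Longrightarrow> \<beta> g x \<in> V'"
    "\<And>g x y. g \<in> carrier G \<Longrightarrow> (x, y) \<in> E' \<Longrightarrow> (\<beta> g x, \<beta> g y) \<in> E'"
  then show "V' = W \<and> E' = barcs" by (rule invariant_subtree_blowup)
qed

text \<open>Reattaching an edge does not change its group: \<open>att\<close> is equivariant, and
  \<open>pr\<close> recovers the original ends.\<close>

lemma fix_lift_iff:
  assumes "g \<in> carrier G" "(x, y) \<in> E"
  shows "\<beta> g (att x y) = att x y \<and> \<beta> g (att y x) = att y x \<longleftrightarrow> \<alpha> g x = x \<and> \<alpha> g y = y"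
proof -
  have yx: "(y, x) \<in> E" using assms arcs_sym by blast
  show ?thesis
    using att_act[OF assms] att_act[OF assms(1) yx] pr_act[OF assms(1) att_in[OF assms(2)]]
      pr_act[OF assms(1) att_in[OF yx]] pr_att[OF assms(2)] pr_att[OF yx] by metis
qed

text \<open>Consequently the edge group of a ray is the whole stabilizer of its far end.\<close>

lemma fix_ray:
  assumes "g \<in> carrier G" "w \<in> W" "\<beta> g w = w"
  shows "\<beta> g (c (pr w)) = c (pr w)"
  using c_act[OF assms(1) pr_in[OF assms(2)]] pr_act[OF assms(1,2)] assms(3) by simp

lemma fix_centre_iff:
  assumes "g \<in> carrier G" "x \<in> V"
  shows "\<beta> g (c x) = c x \<longleftrightarrow> \<alpha> g x = x"
  using c_act[OF assms] pr_c act_in[OF assms] assms by metis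

end

section \<open>Peripheral structures\<close>

lemma arc_act_pair [simp]: "arc_act T g (x, y) = (act T g x, act T g y)"
  by (simp add: arc_act_def)

lemma arc_orbit_eq_iff:
  assumes "is_G_tree G T" "(x, y) \<in> tarcs T" "(x', y') \<in> tarcs T"
  shows "orbit G (arc_act T) (x, y) = orbit G (arc_act T) (x', y') \<longleftrightarrow>
    (\<exists>g\<in>carrier G. x' = act T g x \<and> y' = act T g y)"
proof -
  interpret G_tree G "tverts T" "tarcs T" "act T" using assms(1) by (simp add: is_G_tree_iff)
  interpret group G by (rule group_G)
  note V = arcs_in[OF assms(2)] arcs_in[OF assms(3)]
  have sub: "orbit G (arc_act T) (act T g a, act T g b) \<subseteq> orbit G (arc_act T) (a, b)"
    if g: "g \<in> carrier G" and ab: "a \<in> tverts T" "b \<in> tverts T" for g a b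
  proof
    fix z assume "z \<in> orbit G (arc_act T) (act T g a, act T g b)"
    then obtain h where "h \<in> carrier G" "z = (act T h (act T g a), act T h (act T g b))"
      by (auto simp: orbit_def)
    then have "h \<otimes>\<^bsub>G\<^esub> g \<in> carrier G" "z = arc_act T (h \<otimes>\<^bsub>G\<^esub> g) (a, b)"
      using act_mult[OF _ g] ab g by auto
    then show "z \<in> orbit G (arc_act T) (a, b)" by (auto simp: orbit_def)
  qed
  show ?thesis
  proof
    assume "orbit G (arc_act T) (x, y) = orbit G (arc_act T) (x', y')"
    moreover have "(x', y') = arc_act T \<one>\<^bsub>G\<^esub> (x', y')" using act_one V by simp
    then have "(x', y') \<in> orbit G (arc_act T) (x', y')" unfolding orbit_def by blast
    ultimately have "(x', y') \<in> orbit G (arc_act T) (x, y)" by simp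
    then show "\<exists>g\<in>carrier G. x' = act T g x \<and> y' = act T g y" by (auto simp: orbit_def)
  next
    assume "\<exists>g\<in>carrier G. x' = act T g x \<and> y' = act T g y"
    then obtain g where g: "g \<in> carrier G" "x' = act T g x" "y' = act T g y" by blast
    then have "x = act T (inv\<^bsub>G\<^esub> g) x'" "y = act T (inv\<^bsub>G\<^esub> g) y'" using act_inv V by auto
    then show "orbit G (arc_act T) (x, y) = orbit G (arc_act T) (x', y')"
      using sub[OF g(1) V(1,2)] sub[OF inv_closed[OF g(1)] V(3,4)] g by auto
  qed
qed

text \<open>An arc leaving the orbit of \<open>v\<close> can be translated to one leaving
  \<open>v\<close>. Valence thereby becomes a count of orbits of arcs at \<open>v\<close>.\<close>

lemma out_arcs_quotient_graph:
  assumes "is_G_tree G T" "v \<in> tverts T"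
  shows "out_arcs (quotient_graph G T) (orbit G (act T) v) =
    (\<lambda>u. orbit G (arc_act T) (v, u)) ` {u. (v, u) \<in> tarcs T}"
proof -
  interpret G_tree G "tverts T" "tarcs T" "act T" using assms(1) by (simp add: is_G_tree_iff)
  have fst_orbit: "fst ` orbit G (arc_act T) (x, y) = orbit G (act T) x" for x y
    by (force simp: orbit_def image_iff)
  show ?thesis
  proof (intro equalityI subsetI)
    fix A assume "A \<in> out_arcs (quotient_graph G T) (orbit G (act T) v)"
    then obtain x y where xy: "(x, y) \<in> tarcs T" "A = orbit G (arc_act T) (x, y)"
      "fst ` A = orbit G (act T) v"
      by (auto simp: out_arcs_def quotient_graph_def)
    then have "v \<in> orbit G (act T) x" using orbit_refl[OF assms(2)] fst_orbit by auto
    then obtain g where g: "g \<in> carrier G" "v = act T g x" by (auto simp: orbit_def)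
    then have "(v, act T g y) \<in> tarcs T" using act_arc xy by blast
    moreover from this have "A = orbit G (arc_act T) (v, act T g y)"
      using arc_orbit_eq_iff[OF assms(1) xy(1)] xy g by blast
    ultimately show "A \<in> (\<lambda>u. orbit G (arc_act T) (v, u)) ` {u. (v, u) \<in> tarcs T}" by blast
  qed (use fst_orbit in \<open>auto simp: out_arcs_def quotient_graph_def\<close>)
qed

lemma finite_quotient_arcs:
  assumes "is_G_tree G T" "finitely_generated_group G"
  shows "finite (orbit G (arc_act T) ` tarcs T)"
proof -
  interpret G_tree G "tverts T" "tarcs T" "act T" using assms(1) by (simp add: is_G_tree_iff)
  obtain F where F: "finite F" "F \<subseteq> tarcs T"
    "\<And>x y. (x, y) \<in> tarcs T \<Longrightarrow> \<exists>(a, b)\<in>F. \<exists>g\<in>carrier G. x = act T g a \<and> y = act T g b"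
    using finite_arc_orbits[OF assms(2)] by blast
  have "orbit G (arc_act T) (x, y) \<in> orbit G (arc_act T) ` F" if xy: "(x, y) \<in> tarcs T" for x y
  proof -
    obtain a b where ab: "(a, b) \<in> F" "\<exists>g\<in>carrier G. x = act T g a \<and> y = act T g b"
      using F(3)[OF xy] by blast
    then have "(a, b) \<in> tarcs T" using F(2) by blast
    then show ?thesis using arc_orbit_eq_iff[OF assms(1) _ xy, of a b] ab by blast
  qed
  then have "orbit G (arc_act T) ` tarcs T \<subseteq> orbit G (arc_act T) ` F" by auto
  then show ?thesis using F(1) finite_subset by blast
qed

section \<open>The preorder of conjugation into one another, and its maximal classes\<close>

locale peripheral = group G for G (structure) +
  fixes A :: "'a set set" and G0 :: "'a set"
  assumes G0: "subgroup G0 G" and A_subgroup: "H \<in> A \<Longrightarrow> subgroup H G"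
begin

abbreviation cand where "cand \<equiv> peripheral_candidates A G0"
abbreviation le (infix "\<preceq>" 50) where "H \<preceq> K \<equiv> conj_le G G0 H K"

definition cls where "cls H = {K \<in> cand. H \<preceq> K \<and> K \<preceq> H}"

lemma cand_carrier: "H \<in> cand \<Longrightarrow> H \<subseteq> carrier G"
  using A_subgroup subgroup.subset by (auto simp: peripheral_candidates_def)

lemma G0_carrier: "g \<in> G0 \<Longrightarrow> g \<in> carrier G"
  using subgroup.mem_carrier[OF G0] .

text \<open>Replaces cosets by an elementwise condition, which matches the action on edges in
  \<open>conj_es\<close>.\<close>

lemma conj_le_iff:
  assumes "H \<subseteq> carrier G" "K \<subseteq> carrier G"
  shows "H \<preceq> K \<longleftrightarrow> (\<exists>g\<in>G0. \<forall>h\<in>H. inv g \<otimes> h \<otimes> g \<in> K)"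
proof -
  have "h \<in> g <# K #> inv g \<longleftrightarrow> inv g \<otimes> h \<otimes> g \<in> K" if g: "g \<in> G0" and h: "h \<in> H" for g h
  proof -
    have gc: "g \<in> carrier G" "h \<in> carrier G" using g h assms G0_carrier by auto
    have "h = g \<otimes> k \<otimes> inv g \<longleftrightarrow> inv g \<otimes> h \<otimes> g = k" if k: "k \<in> K" for k
    proof -
      have kc: "k \<in> carrier G" using k assms by blast
      have "h = g \<otimes> k \<otimes> inv g \<longleftrightarrow> g \<otimes> k = h \<otimes> g" using gc kc by (simp add: inv_solve_right)
      also have "\<dots> \<longleftrightarrow> h \<otimes> g = g \<otimes> k" by auto
      also have "\<dots> \<longleftrightarrow> inv g \<otimes> (h \<otimes> g) = k" using gc kc by (simp add: inv_solve_left')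
      finally show ?thesis using gc by (simp add: m_assoc)
    qed
    then show ?thesis unfolding l_coset_def r_coset_def by auto
  qed
  then show ?thesis unfolding conj_le_def by blast
qed

lemma le_mono: "H \<subseteq> K \<Longrightarrow> K \<subseteq> carrier G \<Longrightarrow> H \<preceq> K"
  using conj_le_iff[of H K] subgroup.one_closed[OF G0] by force

lemma le_refl: "H \<in> cand \<Longrightarrow> H \<preceq> H"
  using le_mono cand_carrier by blast

lemma le_trans:
  assumes "H \<in> cand" "K \<in> cand" "L \<in> cand" "H \<preceq> K" "K \<preceq> L"
  shows "H \<preceq> L"
proof -
  note sub = cand_carrier[OF assms(1)] cand_carrier[OF assms(2)] cand_carrier[OF assms(3)]
  obtain g where g: "g \<in> G0" "\<And>h. h \<in> H \<Longrightarrow> inv g \<otimes> h \<otimes> g \<in> K"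
    using assms(4) conj_le_iff[OF sub(1,2)] by blast
  obtain k where k: "k \<in> G0" "\<And>h. h \<in> K \<Longrightarrow> inv k \<otimes> h \<otimes> k \<in> L"
    using assms(5) conj_le_iff[OF sub(2,3)] by blast
  have "inv (g \<otimes> k) \<otimes> h \<otimes> (g \<otimes> k) \<in> L" if h: "h \<in> H" for h
  proof -
    have "inv k \<otimes> (inv g \<otimes> h \<otimes> g) \<otimes> k \<in> L" using g k h by blast
    moreover have "g \<in> carrier G" "k \<in> carrier G" "h \<in> carrier G"
      using g k h sub G0_carrier by auto
    ultimately show ?thesis by (simp add: inv_mult_group m_assoc)
  qed
  then show ?thesis
    using conj_le_iff[OF sub(1,3)] subgroup.m_closed[OF G0 g(1) k(1)] by blast
qed

lemma mem_cls: "H \<in> cand \<Longrightarrow> H \<in> cls H"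
  using le_refl by (simp add: cls_def)

lemma cls_eq_iff:
  assumes "H \<in> cand" "K \<in> cand"
  shows "cls H = cls K \<longleftrightarrow> H \<preceq> K \<and> K \<preceq> H"
proof
  assume "cls H = cls K"
  then show "H \<preceq> K \<and> K \<preceq> H" using mem_cls[OF assms(1)] by (auto simp: cls_def)
next
  assume "H \<preceq> K \<and> K \<preceq> H"
  then show "cls H = cls K" using assms le_trans unfolding cls_def by blast
qed

lemma peripheral_classes_eq: "peripheral_classes G A G0 = cls ` cand"
  unfolding peripheral_classes_def quotient_def cls_def by auto

lemma class_le_iff:
  assumes "H \<in> cand" "K \<in> cand"
  shows "class_le G G0 (cls H) (cls K) \<longleftrightarrow> H \<preceq> K"
proof
  assume "class_le G G0 (cls H) (cls K)"
  then obtain H' K' where "H' \<in> cls H" "K' \<in> cls K" "H' \<preceq> K'" by (auto simp: class_le_def)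
  then have "H' \<in> cand" "K' \<in> cand" "H \<preceq> H'" "H' \<preceq> K'" "K' \<preceq> K" by (auto simp: cls_def)
  then show "H \<preceq> K" using le_trans assms by meson
next
  assume "H \<preceq> K"
  then show "class_le G G0 (cls H) (cls K)" using mem_cls assms by (auto simp: class_le_def)
qed

lemma peripheral_structure_iff:
  "m \<in> peripheral_structure G A G0 \<longleftrightarrow>
    (\<exists>H\<in>cand. m = cls H \<and> (\<forall>K\<in>cand. H \<preceq> K \<longrightarrow> K \<preceq> H))"
proof -
  have "(\<forall>n\<in>cls ` cand. class_le G G0 (cls H) n \<longrightarrow> n = cls H) \<longleftrightarrow>
    (\<forall>K\<in>cand. H \<preceq> K \<longrightarrow> K \<preceq> H)" if H: "H \<in> cand" for H
  proof -
    have "(class_le G G0 (cls H) (cls K) \<longrightarrow> cls K = cls H) \<longleftrightarrow> (H \<preceq> K \<longrightarrow> K \<preceq> H)" if "K \<in> cand" for K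
      unfolding class_le_iff[OF H that] cls_eq_iff[OF that H] by iprover
    then show ?thesis by simp
  qed
  then have "(\<exists>H\<in>cand. m = cls H \<and> (\<forall>n\<in>cls ` cand. class_le G G0 (cls H) n \<longrightarrow> n = cls H)) \<longleftrightarrow>
    (\<exists>H\<in>cand. m = cls H \<and> (\<forall>K\<in>cand. H \<preceq> K \<longrightarrow> K \<preceq> H))"
    by (intro bex_cong refl conj_cong)
  moreover have "m \<in> {m \<in> cls ` cand. P m} \<longleftrightarrow> (\<exists>H\<in>cand. m = cls H \<and> P (cls H))" for P
    by auto
  ultimately show ?thesis
    unfolding peripheral_structure_def peripheral_classes_eq by (simp only:)
qed

lemma peripheral_structure_cls:
  assumes "m \<in> peripheral_structure G A G0" "H \<in> m"
  shows "H \<in> cand" "m = cls H" "K \<in> cand \<Longrightarrow> H \<preceq> K \<Longrightarrow> K \<in> m"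
proof -
  obtain H0 where H0: "H0 \<in> cand" "m = cls H0" "\<And>K. K \<in> cand \<Longrightarrow> H0 \<preceq> K \<Longrightarrow> K \<preceq> H0"
    using assms(1)[unfolded peripheral_structure_iff] by blast
  then have H: "H \<in> cand" "H0 \<preceq> H" "H \<preceq> H0" using assms(2) by (simp_all add: cls_def)
  show "H \<in> cand" by (fact H)
  show "m = cls H" using cls_eq_iff[OF H0(1) H(1)] H H0(2) by blast
  assume K: "K \<in> cand" "H \<preceq> K"
  have "H0 \<preceq> K" using le_trans[OF H0(1) H(1) K(1) H(2) K(2)] .
  then show "K \<in> m" using H0(3)[OF K(1)] K(1) unfolding H0(2) cls_def by blast
qed

text \<open>A finite cofinal set \<open>B\<close> forces maximal elements. Choose \<open>b\<close>
  in \<open>B\<close> above \<open>H\<close> with the fewest members of \<open>B\<close> above it.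
  Anything above \<open>b\<close> lies below some \<open>x\<close> in \<open>B\<close>; the members
  above \<open>x\<close> are among those above \<open>b\<close>, hence equal to them, so
  \<open>b\<close> itself is above \<open>x\<close>.\<close>

lemma maximal_above:
  assumes B: "finite B" "B \<subseteq> cand" "\<And>H. H \<in> cand \<Longrightarrow> \<exists>b\<in>B. H \<preceq> b"
    and H: "H \<in> cand"
  obtains b where "b \<in> B" "H \<preceq> b" "cls b \<in> peripheral_structure G A G0"
proof -
  define U where "U = (\<lambda>b. {x \<in> B. b \<preceq> x})"
  obtain b where b: "b \<in> B \<and> H \<preceq> b"
    and min: "\<And>x. x \<in> B \<and> H \<preceq> x \<Longrightarrow> card (U b) \<le> card (U x)"
    using B(3)[OF H] ex_has_least_nat[of "\<lambda>b. b \<in> B \<and> H \<preceq> b" _ "\<lambda>b. card (U b)"] by blast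
  have "K \<preceq> b" if K: "K \<in> cand" "b \<preceq> K" for K
  proof -
    obtain x where x: "x \<in> B" "K \<preceq> x" using B(3) K by blast
    have in_cand: "b \<in> cand" "x \<in> cand" using b x B by auto
    have bx: "b \<preceq> x" using le_trans[OF in_cand(1) K(1) in_cand(2) K(2) x(2)] .
    then have "H \<preceq> x" using le_trans[OF H in_cand] b by blast
    then have "card (U b) \<le> card (U x)" using min x by blast
    moreover have "U x \<subseteq> U b" using le_trans[OF in_cand _ bx] B by (auto simp: U_def)
    moreover have "finite (U b)" using B by (simp add: U_def)
    ultimately have "U x = U b" using card_seteq by blast
    then have "x \<preceq> b" using b in_cand le_refl by (auto simp: U_def)
    then show ?thesis using le_trans[OF K(1) in_cand(2,1) x(2)] by blast
  qed
  then have "cls b \<in> peripheral_structure G A G0"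
    using b B by (auto simp: peripheral_structure_iff)
  with b that show thesis by blast
qed

end

section \<open>Edge groups at \<open>v\<close> and the lower bound on the valence\<close>

locale peripheral_vertex =
  fixes G :: "('g, 'x) monoid_scheme" (structure)
    and D :: "('g, 'v) acted_graph set" and G0 :: "'g set"
    and T :: "('g, 'v) acted_graph" and v :: 'v
  assumes fg: "finitely_generated_group G"
    and D: "deformation_space G D"
    and G0_notin: "G0 \<notin> A_min G D"
    and T: "T \<in> reduced_deformation_space G D"
    and v: "v \<in> tverts T"
    and stab_v: "vertex_stab G T v = G0"
begin

abbreviation A where "A \<equiv> A_min G D"
abbreviation M0 where "M0 \<equiv> peripheral_structure G A G0"
abbreviation es where "es u \<equiv> edge_stab G T (v, u)"

lemma T_tree: "is_G_tree G T"
  using T D by (auto simp: reduced_deformation_space_def deformation_space_def)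

sublocale T: G_tree G "tverts T" "tarcs T" "act T"
  using T_tree by (simp add: is_G_tree_iff)

lemma mem_G0: "g \<in> G0 \<longleftrightarrow> g \<in> carrier G \<and> act T g v = v"
  using stab_v mem_vertex_stab by metis

sublocale P: peripheral G A G0
proof (intro peripheral.intro peripheral_axioms.intro T.group_G)
  show "subgroup G0 G" using elliptic_vertex_stab[OF T_tree v] stab_v by (simp add: elliptic_def)
qed (auto simp: A_min_def bi_elliptic_def)

lemma edge_stab_A: "e \<in> tarcs T \<Longrightarrow> edge_stab G T e \<in> A"
  using T by (simp add: reduced_deformation_space_def)

lemma es_cand: "(v, u) \<in> tarcs T \<Longrightarrow> es u \<in> P.cand"
  using edge_stab_A mem_G0 by (auto simp: peripheral_candidates_def)

text \<open>The edge fixed by \<open>H\<close> may be far from \<open>v\<close>; but then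
  \<open>H\<close> fixes \<open>v\<close> as well as an end of that edge, hence the first edge on
  the path between them.\<close>

lemma cand_edge:
  assumes "H \<in> P.cand"
  obtains u where "(v, u) \<in> tarcs T" "H \<subseteq> es u"
proof -
  have H: "H \<in> A" "H \<subseteq> G0" using assms by (auto simp: peripheral_candidates_def)
  then obtain R where R: "R \<in> D" "reduced G R" "bi_elliptic G R H" by (auto simp: A_min_def)
  have "is_G_tree G R" "\<And>K. elliptic G R K \<longleftrightarrow> elliptic G T K"
    using D R(1) T by (auto simp: deformation_space_def reduced_deformation_space_def)
  then have "bi_elliptic G T H" using reduced_bi_elliptic[OF _ R(2) T_tree _ R(3)] by blast
  then obtain a b where ab: "(a, b) \<in> tarcs T" "H \<subseteq> edge_stab G T (a, b)" and sub: "subgroup H G"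
    by (auto simp: bi_elliptic_def)
  show thesis
  proof (cases "a = v")
    case True
    then show thesis using that ab by blast
  next
    case False
    have "act T h v = v" "act T h a = a" if "h \<in> H" for h using that H mem_G0 ab by auto
    then show thesis
      using bi_elliptic_fix_two[OF T_tree sub v T.arcs_in(1)[OF ab(1)]] that False by metis
  qed
qed

lemma conj_es:
  assumes "g \<in> G0" "(v, u) \<in> tarcs T" "h \<in> carrier G"
  shows "inv g \<otimes> h \<otimes> g \<in> es u \<longleftrightarrow> h \<in> es (act T g u)"
proof -
  note gc = P.G0_carrier[OF assms(1)]
  have "act T (inv g \<otimes> h \<otimes> g) x = x \<longleftrightarrow> act T h (act T g x) = act T g x" if "x \<in> tverts T" for x
  proof -
    have "act T (inv g \<otimes> h \<otimes> g) x = act T (inv g) (act T h (act T g x))"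
      using gc assms(3) that by (simp add: T.act_mult T.act_in)
    moreover have "act T h (act T g x) \<in> tverts T" using gc assms(3) that T.act_in by blast
    ultimately show ?thesis
      using T.act_inv[OF gc that] T.act_inv'[OF gc, of "act T h (act T g x)"] by auto
  qed
  from this[of v] this[of u] show ?thesis
    using assms gc T.arcs_in[OF assms(2)] mem_G0[of g] by auto
qed

lemma translate_arc: "g \<in> G0 \<Longrightarrow> (v, u) \<in> tarcs T \<Longrightarrow> (v, act T g u) \<in> tarcs T"
  using T.act_arc[of g v u] mem_G0 by simp

lemma es_translate:
  assumes "g \<in> G0" "(v, u) \<in> tarcs T"
  shows "P.cls (es (act T g u)) = P.cls (es u)"
proof -
  have le: "conj_le G G0 (es (act T h w)) (es w)" if "h \<in> G0" "(v, w) \<in> tarcs T" for h w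
  proof -
    have "es (act T h w) \<subseteq> carrier G" "es w \<subseteq> carrier G" by auto
    then show ?thesis using P.conj_le_iff conj_es[OF that] that(1) by blast
  qed
  have "act T (inv g) (act T g u) = u" using T.act_inv assms T.arcs_in mem_G0 by blast
  then have "conj_le G G0 (es u) (es (act T g u))"
    using le[of "inv g" "act T g u"] translate_arc[OF assms] subgroup.m_inv_closed[OF P.G0 assms(1)] by simp
  then show ?thesis
    using le[OF assms] P.cls_eq_iff[OF es_cand es_cand] translate_arc[OF assms] assms by blast
qed

lemma es_orbit:
  assumes "(v, u) \<in> tarcs T" "(v, u') \<in> tarcs T"
  shows "orbit G (arc_act T) (v, u) = orbit G (arc_act T) (v, u') \<longleftrightarrow> (\<exists>g\<in>G0. u' = act T g u)"
  using arc_orbit_eq_iff[OF T_tree assms] mem_G0 by metis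

lemma finite_out_arcs: "finite ((\<lambda>u. orbit G (arc_act T) (v, u)) ` {u. (v, u) \<in> tarcs T})"
  by (rule finite_subset[OF _ finite_quotient_arcs[OF T_tree fg]]) auto

text \<open>Finitely many edges represent all orbits at \<open>v\<close>, and their groups are
  cofinal among the candidates. This gives a maximal class above \<open>H\<close>, with one of these
  edge groups in it.\<close>

lemma dominating:
  assumes H: "H \<in> P.cand"
  obtains m u where "m \<in> M0" "(v, u) \<in> tarcs T" "es u \<in> m" "H \<subseteq> es u"
proof -
  let ?o = "\<lambda>u. orbit G (arc_act T) (v, u)"
  obtain U where U: "U \<subseteq> {u. (v, u) \<in> tarcs T}" "finite U" "?o ` {u. (v, u) \<in> tarcs T} = ?o ` U"
    using finite_subset_image[OF finite_out_arcs subset_refl] by blast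
  have "\<exists>b\<in>es ` U. conj_le G G0 K b" if K: "K \<in> P.cand" for K
  proof -
    obtain u where u: "(v, u) \<in> tarcs T" "K \<subseteq> es u" using cand_edge[OF K] .
    then obtain u' where u': "u' \<in> U" "?o u = ?o u'" using U(3) by blast
    then obtain g where "g \<in> G0" "u' = act T g u" using es_orbit[of u u'] u U(1) by blast
    then have "P.cls (es u') = P.cls (es u)" using es_translate u by blast
    then have "conj_le G G0 (es u) (es u')"
      using P.cls_eq_iff[of "es u'" "es u"] es_cand u u' U(1) by blast
    moreover have "conj_le G G0 K (es u)" using P.le_mono u P.cand_carrier es_cand by blast
    ultimately have "conj_le G G0 K (es u')"
      using P.le_trans[OF K, of "es u" "es u'"] es_cand u u' U(1) by blast
    then show ?thesis using u' by blast
  qed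
  moreover have "es ` U \<subseteq> P.cand" using U es_cand by blast
  ultimately obtain b where b: "b \<in> es ` U" "conj_le G G0 H b" "P.cls b \<in> M0"
    using P.maximal_above[of "es ` U" H] U(2) H by blast
  then obtain u where u: "(v, u) \<in> tarcs T" "b = es u" using U by blast
  \<comment> \<open>So far \<open>H\<close> is contained in the edge group only up to conjugacy;
    translating the edge by \<open>g\<close> makes it an inclusion without changing the
    class.\<close>
  obtain g where g: "g \<in> G0" "\<And>h. h \<in> H \<Longrightarrow> inv g \<otimes> h \<otimes> g \<in> es u"
    using b(2) u P.conj_le_iff[OF P.cand_carrier[OF H] P.cand_carrier[OF es_cand[OF u(1)]]] by blast
  then have "H \<subseteq> es (act T g u)" using conj_es[OF g(1) u(1)] P.cand_carrier[OF H] by blast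
  moreover have "es (act T g u) \<in> P.cls b"
    using P.mem_cls[OF es_cand[OF translate_arc[OF g(1) u(1)]]] es_translate[OF g(1) u(1)] u by simp
  ultimately show thesis using that b(3) translate_arc[OF g(1) u(1)] by blast
qed

text \<open>A group in \<open>m\<close> lies in some edge group at \<open>v\<close>, and by
  maximality of \<open>m\<close> that edge group belongs to \<open>m\<close> as well.\<close>

lemma peripheral_edge:
  assumes "m \<in> M0"
  obtains u where "(v, u) \<in> tarcs T" "es u \<in> m"
proof -
  obtain H where H: "H \<in> P.cand" "m = P.cls H"
    using assms[unfolded P.peripheral_structure_iff] by blast
  obtain u where u: "(v, u) \<in> tarcs T" "H \<subseteq> es u" using cand_edge[OF H(1)] .
  then have "conj_le G G0 H (es u)" using P.le_mono P.cand_carrier[OF es_cand] by blast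
  then have "es u \<in> m"
    using P.peripheral_structure_cls(3)[OF assms] P.mem_cls[OF H(1)] H es_cand u by blast
  with u that show thesis by blast
qed

definition edge_of where "edge_of m = (SOME u. (v, u) \<in> tarcs T \<and> es u \<in> m)"

lemma edge_of: "m \<in> M0 \<Longrightarrow> (v, edge_of m) \<in> tarcs T" "m \<in> M0 \<Longrightarrow> es (edge_of m) \<in> m"
proof -
  assume m: "m \<in> M0"
  have "\<exists>u. (v, u) \<in> tarcs T \<and> es u \<in> m" using peripheral_edge[OF m] by blast
  from someI_ex[OF this] show "(v, edge_of m) \<in> tarcs T" "es (edge_of m) \<in> m"
    unfolding edge_of_def by blast+
qed

text \<open>An orbit of edges at \<open>v\<close> determines the class of its edge groups, so
  distinct classes use distinct orbits. This is the source of the inequality for the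
  valence.\<close>

lemma edge_of_orbit:
  assumes m: "m \<in> M0" "m' \<in> M0" and g: "g \<in> G0" "edge_of m' = act T g (edge_of m)"
  shows "m = m'"
  using es_translate[OF g(1) edge_of(1)[OF m(1)]] P.peripheral_structure_cls(2)[OF m(1) edge_of(2)[OF m(1)]]
    P.peripheral_structure_cls(2)[OF m(2) edge_of(2)[OF m(2)]] g by simp

lemma inj_edge_of: "inj_on (\<lambda>m. orbit G (arc_act T) (v, edge_of m)) M0"
proof (rule inj_onI)
  fix m m'
  assume m: "m \<in> M0" "m' \<in> M0"
    and eq: "orbit G (arc_act T) (v, edge_of m) = orbit G (arc_act T) (v, edge_of m')"
  obtain g where "g \<in> G0" "edge_of m' = act T g (edge_of m)"
    using eq es_orbit[OF edge_of(1)[OF m(1)] edge_of(1)[OF m(2)]] by blast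
  then show "m = m'" using edge_of_orbit m by blast
qed

lemma card_le_valence:
  "finite M0 \<and> enat (card M0) \<le> valence (quotient_graph G T) (orbit G (act T) v)"
proof -
  let ?O = "(\<lambda>u. orbit G (arc_act T) (v, u)) ` {u. (v, u) \<in> tarcs T}"
  have sub: "(\<lambda>m. orbit G (arc_act T) (v, edge_of m)) ` M0 \<subseteq> ?O" using edge_of by blast
  have "finite M0" using inj_on_finite[OF inj_edge_of sub finite_out_arcs] .
  moreover have "card M0 \<le> card ?O" using card_inj_on_le[OF inj_edge_of sub finite_out_arcs] .
  ultimately show ?thesis
    unfolding valence_def out_degree_def out_arcs_quotient_graph[OF T_tree v]
    using finite_out_arcs by simp
qed

end

section \<open>Sliding edges\<close>

text \<open>The premise \<open>ext\<close> is there because \<open>BijGroup\<close> consists of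
  extensional functions.\<close>

lemma group_actionI:
  fixes G (structure)
  assumes "group G"
    and closed: "\<And>g w. g \<in> carrier G \<Longrightarrow> w \<in> W \<Longrightarrow> \<beta> g w \<in> W"
    and ext: "\<And>g. g \<in> carrier G \<Longrightarrow> \<beta> g \<in> extensional W"
    and one: "\<And>w. w \<in> W \<Longrightarrow> \<beta> \<one> w = w"
    and mult: "\<And>g h w. g \<in> carrier G \<Longrightarrow> h \<in> carrier G \<Longrightarrow> w \<in> W \<Longrightarrow> \<beta> (g \<otimes> h) w = \<beta> g (\<beta> h w)"
  shows "group_action G W \<beta>"
proof -
  interpret group G by fact
  have bij: "\<beta> g \<in> Bij W" if g: "g \<in> carrier G" for g
  proof -
    have "\<beta> (inv g) (\<beta> g w) = w" "\<beta> g (\<beta> (inv g) w) = w" if "w \<in> W" for w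
      using mult[of "inv g" g w] mult[of g "inv g" w] one g that by auto
    then have "bij_betw (\<beta> g) W W"
      using closed[OF g] closed[OF inv_closed[OF g]]
      by (intro bij_betw_byWitness[where f' = "\<beta> (inv g)"]) auto
    then show ?thesis using ext[OF g] by (simp add: Bij_def)
  qed
  have "\<beta> (g \<otimes> h) = compose W (\<beta> g) (\<beta> h)" if "g \<in> carrier G" "h \<in> carrier G" for g h
    using that mult ext[of "g \<otimes> h"] by (intro extensionalityI[of _ W]) (auto simp: compose_eq)
  then have "\<beta> \<in> hom G (BijGroup W)" using bij by (auto simp: hom_def BijGroup_def)
  then show ?thesis
    by (intro group_action.intro group_hom.intro group_hom_axioms.intro group_BijGroup assms(1))
qed

text \<open>An equivariant map can be prescribed on one representative of each orbit, as long as the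
  stabilizer of the representative fixes its image.\<close>

lemma equivariant_choice:
  fixes G (structure)
  assumes "group G"
    and a_closed: "\<And>g x. g \<in> carrier G \<Longrightarrow> x \<in> X \<Longrightarrow> a g x \<in> X"
    and a_one: "\<And>x. x \<in> X \<Longrightarrow> a \<one> x = x"
    and a_mult: "\<And>g h x. g \<in> carrier G \<Longrightarrow> h \<in> carrier G \<Longrightarrow> x \<in> X \<Longrightarrow> a (g \<otimes> h) x = a g (a h x)"
    and b_closed: "\<And>g y. g \<in> carrier G \<Longrightarrow> y \<in> Y \<Longrightarrow> b g y \<in> Y"
    and b_one: "\<And>y. y \<in> Y \<Longrightarrow> b \<one> y = y"
    and b_mult: "\<And>g h y. g \<in> carrier G \<Longrightarrow> h \<in> carrier G \<Longrightarrow> y \<in> Y \<Longrightarrow> b (g \<otimes> h) y = b g (b h y)"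
    and P: "\<And>g x y. g \<in> carrier G \<Longrightarrow> x \<in> X \<Longrightarrow> y \<in> Y \<Longrightarrow> P x y \<Longrightarrow> P (a g x) (b g y)"
    and ex: "\<And>x. x \<in> X \<Longrightarrow> \<exists>y\<in>Y. P x y \<and> (\<forall>g\<in>carrier G. a g x = x \<longrightarrow> b g y = y)"
  obtains f where "\<And>x. x \<in> X \<Longrightarrow> f x \<in> Y" "\<And>x. x \<in> X \<Longrightarrow> P x (f x)"
    "\<And>g x. g \<in> carrier G \<Longrightarrow> x \<in> X \<Longrightarrow> f (a g x) = b g (f x)"
proof -
  interpret group G by fact
  define orb where "orb x = (\<lambda>g. a g x) ` carrier G" for x
  \<comment> \<open>Choosing from the set \<open>orb x\<close> makes \<open>rep\<close> depend on
    the orbit alone.\<close>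
  define rep where "rep x = (SOME z. z \<in> orb x)" for x
  have orb_act: "orb (a g x) = orb x" if g: "g \<in> carrier G" and x: "x \<in> X" for g x
  proof -
    have sub: "orb (a h z) \<subseteq> orb z" if "h \<in> carrier G" "z \<in> X" for h z
      using that a_mult[symmetric] by (auto simp: orb_def)
    have "a (inv g) (a g x) = x" using a_mult[of "inv g" g x] a_one g x by simp
    then show ?thesis using sub[OF g x] sub[OF inv_closed[OF g] a_closed[OF g x]] by auto
  qed
  have rep: "rep x \<in> X \<and> (\<exists>g\<in>carrier G. x = a g (rep x))" if x: "x \<in> X" for x
  proof -
    have "a \<one> x \<in> orb x" unfolding orb_def by blast
    then have "rep x \<in> orb x" unfolding rep_def by (rule someI)
    then obtain h where h: "h \<in> carrier G" "rep x = a h x" by (auto simp: orb_def)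
    then have "x = a (inv h) (rep x)" using a_mult[of "inv h" h x] a_one x by simp
    moreover have "rep x \<in> X" using h a_closed x by simp
    ultimately show ?thesis using inv_closed[OF h(1)] by blast
  qed
  obtain y where y: "\<And>x. x \<in> X \<Longrightarrow> y x \<in> Y" "\<And>x. x \<in> X \<Longrightarrow> P x (y x)"
    "\<And>x g. x \<in> X \<Longrightarrow> g \<in> carrier G \<Longrightarrow> a g x = x \<Longrightarrow> b g (y x) = y x"
    using ex by metis
  define tr where "tr x = (SOME g. g \<in> carrier G \<and> x = a g (rep x))" for x
  have tr: "tr x \<in> carrier G" "x = a (tr x) (rep x)" if x: "x \<in> X" for x
  proof -
    have "\<exists>g. g \<in> carrier G \<and> x = a g (rep x)" using rep[OF x] by blast
    from someI_ex[OF this] show "tr x \<in> carrier G" "x = a (tr x) (rep x)"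
      unfolding tr_def by blast+
  qed
  define f where "f x = b (tr x) (y (rep x))" for x
  \<comment> \<open>Independence of the choice of \<open>tr x\<close>: two choices differ by an
    element of the stabilizer of \<open>rep x\<close>, which fixes the prescribed value.\<close>
  have f_eq: "f x = b g (y (rep x))" if x: "x \<in> X" and g: "g \<in> carrier G" "x = a g (rep x)" for g x
  proof -
    let ?k = "inv g \<otimes> tr x"
    have k: "?k \<in> carrier G" using g tr x by auto
    note rx = rep[OF x, THEN conjunct1]
    have "a ?k (rep x) = a (inv g) (a (tr x) (rep x))" using a_mult g tr(1)[OF x] rx by simp
    also have "\<dots> = a (inv g) (a g (rep x))" using g tr(2)[OF x] by simp
    also have "\<dots> = rep x" using a_mult[of "inv g" g "rep x"] a_one g rx by simp
    finally have "b ?k (y (rep x)) = y (rep x)" using y(3) rx k by blast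
    then have "b g (b ?k (y (rep x))) = b g (y (rep x))" by simp
    moreover have "b g (b ?k (y (rep x))) = b (g \<otimes> ?k) (y (rep x))"
      using b_mult[OF g(1) k y(1)[OF rx]] by simp
    moreover have "g \<otimes> ?k = tr x" using g(1) tr(1)[OF x] by (simp add: m_assoc[symmetric])
    ultimately show ?thesis by (simp add: f_def)
  qed
  show thesis
  proof
    fix x assume x: "x \<in> X"
    show "f x \<in> Y" using b_closed tr(1)[OF x] y(1) rep[OF x] by (simp add: f_def)
    have "P (a (tr x) (rep x)) (f x)"
      using P tr(1)[OF x] y rep[OF x] by (simp add: f_def)
    then show "P x (f x)" using tr(2)[OF x] by simp
  next
    fix g x assume g: "g \<in> carrier G" and x: "x \<in> X"
    have r: "rep (a g x) = rep x" using orb_act[OF g x] by (simp add: rep_def)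
    have rx: "rep x \<in> X" using rep[OF x] by blast
    have "a g x = a (g \<otimes> tr x) (rep x)" using a_mult[OF g tr(1)[OF x] rx] tr(2)[OF x] by simp
    then have "f (a g x) = b (g \<otimes> tr x) (y (rep x))"
      using f_eq[OF a_closed[OF g x], of "g \<otimes> tr x"] g tr(1)[OF x] r by simp
    also have "\<dots> = b g (f x)" using b_mult[OF g tr(1)[OF x] y(1)[OF rx]] by (simp add: f_def)
    finally show "f (a g x) = b g (f x)" .
  qed
qed

section \<open>Rays and the equivariant choice of where to slide\<close>

context peripheral_vertex
begin

text \<open>These arcs of \<open>T\<close> also serve as names for the far ends of the new edges, so
  that each new edge inherits the stabilizer of its name.\<close>

definition rays where
  "rays = {(act T g v, act T g (edge_of m)) |g m. g \<in> carrier G \<and> m \<in> M0}"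

definition star_arcs where
  "star_arcs = {e \<in> tarcs T. fst e \<in> orbit G (act T) v}"

lemma arc_act_mult: "g \<in> carrier G \<Longrightarrow> h \<in> carrier G \<Longrightarrow> e \<in> tarcs T \<Longrightarrow>
    arc_act T (g \<otimes> h) e = arc_act T g (arc_act T h e)"
  by (cases e) (auto simp: T.act_mult T.arcs_in)

lemma arc_act_one: "e \<in> tarcs T \<Longrightarrow> arc_act T \<one> e = e"
  by (cases e) (auto simp: T.act_one T.arcs_in)

lemma arc_act_arc: "g \<in> carrier G \<Longrightarrow> e \<in> tarcs T \<Longrightarrow> arc_act T g e \<in> tarcs T"
  by (cases e) (auto simp: T.act_arc)

lemma arc_act_fst: "fst (arc_act T g e) = act T g (fst e)"
  by (cases e) auto

lemma act_orbit: "g \<in> carrier G \<Longrightarrow> x \<in> orbit G (act T) v \<Longrightarrow> act T g x \<in> orbit G (act T) v"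
  using T.act_mult[OF _ _ v, symmetric] unfolding orbit_def by auto

lemma act_orbit_iff:
  assumes "g \<in> carrier G" "x \<in> tverts T"
  shows "act T g x \<in> orbit G (act T) v \<longleftrightarrow> x \<in> orbit G (act T) v"
  using act_orbit[OF assms(1), of x] act_orbit[OF P.inv_closed[OF assms(1)], of "act T g x"]
    T.act_inv[OF assms] by auto

lemma rays_arcs: "rays \<subseteq> tarcs T"
  using T.act_arc edge_of by (auto simp: rays_def)

lemma rays_star: "rays \<subseteq> star_arcs"
  using rays_arcs by (auto simp: rays_def star_arcs_def orbit_def)

lemma rays_act:
  assumes g: "g \<in> carrier G" and n: "n \<in> rays"
  shows "arc_act T g n \<in> rays"
proof -
  obtain h m where h: "h \<in> carrier G" "m \<in> M0" "n = (act T h v, act T h (edge_of m))"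
    using n by (auto simp: rays_def)
  then have "arc_act T g n = (act T (g \<otimes> h) v, act T (g \<otimes> h) (edge_of m))"
    using g v T.arcs_in(2)[OF edge_of(1)] by (simp add: T.act_mult)
  then show ?thesis using h g by (auto simp: rays_def)
qed

lemma rays_at_v: "(v, u) \<in> rays \<longleftrightarrow> (\<exists>g\<in>G0. \<exists>m\<in>M0. u = act T g (edge_of m))"
  using mem_G0 by (force simp: rays_def)

text \<open>The edge from \<open>dominating\<close> need not be a chosen one, but its group is
  equivalent to that of the chosen edge of its class. A translate of the chosen edge then contains
  it.\<close>

lemma dominating_ray:
  assumes H: "H \<in> P.cand"
  obtains w where "(v, w) \<in> rays" "H \<subseteq> es w"
proof -
  obtain m u where m: "m \<in> M0" "(v, u) \<in> tarcs T" "es u \<in> m" "H \<subseteq> es u" using dominating[OF H] .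
  note e = edge_of[OF m(1)]
  have "P.cls (es u) = P.cls (es (edge_of m))"
    using P.peripheral_structure_cls(2)[OF m(1)] m(3) e(2) by metis
  then have "conj_le G G0 (es u) (es (edge_of m))"
    using P.cls_eq_iff[OF es_cand[OF m(2)] es_cand[OF e(1)]] by blast
  then obtain g where g: "g \<in> G0" "\<And>h. h \<in> es u \<Longrightarrow> inv g \<otimes> h \<otimes> g \<in> es (edge_of m)"
    using P.conj_le_iff[OF P.cand_carrier[OF es_cand[OF m(2)]] P.cand_carrier[OF es_cand[OF e(1)]]]
    by blast
  have "es u \<subseteq> es (act T g (edge_of m))"
  proof
    fix h assume h: "h \<in> es u"
    then have "h \<in> carrier G" by simp
    from conj_es[OF g(1) e(1) this] g(2)[OF h] show "h \<in> es (act T g (edge_of m))" by (rule iffD1)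
  qed
  moreover have "(v, act T g (edge_of m)) \<in> rays" using rays_at_v g(1) m(1) by blast
  ultimately show thesis using that m(4) by blast
qed

text \<open>Equivariance requires the group of an edge to fix the ray assigned to it, which is what
  domination supplies. Being the identity on \<open>rays\<close> guarantees that every ray carries
  an edge at its far end.\<close>

lemma retraction:
  obtains \<rho> where "\<And>e. e \<in> star_arcs \<Longrightarrow> \<rho> e \<in> rays" "\<And>e. e \<in> star_arcs \<Longrightarrow> fst (\<rho> e) = fst e"
    "\<And>e. e \<in> rays \<Longrightarrow> \<rho> e = e"
    "\<And>g e. g \<in> carrier G \<Longrightarrow> e \<in> star_arcs \<Longrightarrow> \<rho> (arc_act T g e) = arc_act T g (\<rho> e)"
proof -
  let ?P = "\<lambda>e n. fst n = fst e \<and> (e \<in> rays \<longrightarrow> n = e)"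
  have ex: "\<exists>n\<in>rays. ?P e n \<and> (\<forall>h\<in>carrier G. arc_act T h e = e \<longrightarrow> arc_act T h n = n)"
    if e: "e \<in> star_arcs" for e
  proof (cases "e \<in> rays")
    case True
    then show ?thesis by blast
  next
    case False
    obtain x y where xy: "e = (x, y)" "(x, y) \<in> tarcs T" "x \<in> orbit G (act T) v"
      using e by (cases e) (auto simp: star_arcs_def)
    obtain g where g: "g \<in> carrier G" "x = act T g v" using xy(3) by (auto simp: orbit_def)
    \<comment> \<open>The edge is carried back to \<open>v\<close>, dominated there by a ray, and
      the ray is carried out again.\<close>
    let ?u = "act T (inv g) y"
    have gi: "inv g \<in> carrier G" using g by simp
    have y: "y \<in> tverts T" using xy(2) T.arcs_in by blast
    have gu: "act T g ?u = y" using T.act_inv'[OF g(1) y] .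
    have vu: "(v, ?u) \<in> tarcs T" using T.act_arc[OF gi xy(2)] T.act_inv[OF g(1) v] g(2) by simp
    obtain w where w: "(v, w) \<in> rays" "es ?u \<subseteq> es w" using dominating_ray[OF es_cand[OF vu]] .
    have wV: "w \<in> tverts T" using w(1) rays_arcs T.arcs_in by blast
    have "arc_act T h (x, act T g w) = (x, act T g w)"
      if h: "h \<in> carrier G" "arc_act T h e = e" for h
    proof -
      let ?k = "inv g \<otimes> h \<otimes> g"
      have k: "?k \<in> carrier G" using g h by simp
      have act_k: "act T ?k z = act T (inv g) (act T h (act T g z))" if "z \<in> tverts T" for z
        using g(1) h(1) that by (simp add: T.act_mult T.act_in)
      have "act T h x = x" "act T h y = y" using h(2) xy(1) by auto
      then have "?k \<in> es ?u"
        using k act_k[OF v] act_k[OF T.act_in[OF gi y]] g T.act_inv[OF g(1) v] gu by simp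
      then have "act T (inv g) (act T h (act T g w)) = w" using w(2) act_k[OF wV] by auto
      then have "act T g (act T (inv g) (act T h (act T g w))) = act T g w" by simp
      then have "act T h (act T g w) = act T g w"
        using T.act_inv'[OF g(1), of "act T h (act T g w)"] T.act_in[OF h(1) T.act_in[OF g(1) wV]] by simp
      then show ?thesis using \<open>act T h x = x\<close> by simp
    qed
    moreover have "(x, act T g w) \<in> rays" using rays_act[OF g(1) w(1)] g(2) by simp
    ultimately show ?thesis using False xy(1) by (intro bexI[of _ "(x, act T g w)"]) auto
  qed
  have star_act: "arc_act T g e \<in> star_arcs" if "g \<in> carrier G" "e \<in> star_arcs" for g e
    using that arc_act_arc act_orbit by (auto simp: star_arcs_def arc_act_fst)
  have star_tarcs: "e \<in> tarcs T" if "e \<in> star_arcs" for e using that by (simp add: star_arcs_def)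
  \<comment> \<open>The condition that rays are kept transfers because a translate can be a ray only
    if \<open>e\<close> already is one.\<close>
  have P_act: "?P (arc_act T g e) (arc_act T g n)"
    if g: "g \<in> carrier G" and e: "e \<in> star_arcs" and n: "n \<in> rays" and P: "?P e n" for g e n
  proof -
    have "e \<in> rays" if "arc_act T g e \<in> rays"
    proof -
      have "e = arc_act T (inv g) (arc_act T g e)"
        using arc_act_mult[of "inv g" g e] arc_act_one star_tarcs[OF e] g by simp
      then show ?thesis using rays_act[OF P.inv_closed[OF g] that] by simp
    qed
    then show ?thesis using P by (auto simp: arc_act_fst)
  qed
  show thesis
  proof (rule equivariant_choice[OF T.group_G, of star_arcs "arc_act T" rays "arc_act T" ?P])
    show "arc_act T \<one> e = e" if "e \<in> star_arcs" for e
      using arc_act_one star_tarcs that by blast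
    show "arc_act T \<one> e = e" if "e \<in> rays" for e
      using arc_act_one rays_arcs that by blast
    show "arc_act T (g \<otimes> h) e = arc_act T g (arc_act T h e)"
      if "g \<in> carrier G" "h \<in> carrier G" "e \<in> star_arcs" for g h e
      using arc_act_mult star_tarcs that by blast
    show "arc_act T (g \<otimes> h) e = arc_act T g (arc_act T h e)"
      if "g \<in> carrier G" "h \<in> carrier G" "e \<in> rays" for g h e
      using arc_act_mult rays_arcs that by blast
    show "arc_act T g e \<in> star_arcs" if "g \<in> carrier G" "e \<in> star_arcs" for g e
      using that by (rule star_act)
    show "arc_act T g e \<in> rays" if "g \<in> carrier G" "e \<in> rays" for g e
      using that by (rule rays_act)
    show "?P (arc_act T g e) (arc_act T g n)"
      if "g \<in> carrier G" "e \<in> star_arcs" "n \<in> rays" "?P e n" for g e n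
      using that by (rule P_act)
    show "\<exists>n\<in>rays. ?P e n \<and> (\<forall>g\<in>carrier G. arc_act T g e = e \<longrightarrow> arc_act T g n = n)"
      if "e \<in> star_arcs" for e using that by (rule ex)
  next
    fix \<rho>
    assume \<rho>: "\<And>x. x \<in> star_arcs \<Longrightarrow> \<rho> x \<in> rays" "\<And>x. x \<in> star_arcs \<Longrightarrow> ?P x (\<rho> x)"
      "\<And>g x. g \<in> carrier G \<Longrightarrow> x \<in> star_arcs \<Longrightarrow> \<rho> (arc_act T g x) = arc_act T g (\<rho> x)"
    show thesis
    proof (rule that[of \<rho>])
      show "fst (\<rho> e) = fst e" if "e \<in> star_arcs" for e using \<rho>(2)[OF that] by simp
      show "\<rho> e = e" if "e \<in> rays" for e using \<rho>(2)[OF subsetD[OF rays_star that]] that by simp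
    qed (fact \<rho>(1) \<rho>(3))+
  qed
qed

text \<open>If \<open>G0\<close> fixed \<open>u\<close>, it would be an edge group of
  \<open>T\<close> and thus belong to \<open>A_min\<close>. So each edge at \<open>v\<close> has a
  second translate at \<open>v\<close>.\<close>

lemma moved_neighbour:
  assumes "(v, u) \<in> tarcs T"
  obtains g where "g \<in> G0" "act T g u \<noteq> u"
proof -
  have "es u \<subseteq> G0" using mem_G0 by (simp add: subset_iff)
  moreover have "es u \<noteq> G0" using edge_stab_A[OF assms] G0_notin by metis
  ultimately obtain g where "g \<in> G0" "g \<notin> es u" by blast
  then have "act T g u \<noteq> u" using mem_G0[of g] by simp
  with \<open>g \<in> G0\<close> that show thesis by blast
qed

text \<open>All trees of \<open>D\<close> share one vertex type. Since \<open>v\<close> has two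
  neighbours the vertex set is infinite, so there is room in it for the vertices together with the
  rays.\<close>

lemma encoding:
  includes cardinal_syntax
  assumes "(v, u) \<in> tarcs T"
  obtains j :: "'v + 'v \<times> 'v \<Rightarrow> 'v" where "inj_on j (Inl ` tverts T \<union> Inr ` rays)"
proof -
  let ?V = "tverts T"
  obtain g where g: "g \<in> G0" "act T g u \<noteq> u" using moved_neighbour[OF assms] .
  then have inf: "infinite ?V"
    using T.infinite_verts[OF assms translate_arc[OF g(1) assms]] by auto
  have "|?V \<times> ?V| \<le>o |?V|"
    using card_of_Times_same_infinite[OF inf] ordIso_imp_ordLeq by blast
  then have "|?V <+> ?V \<times> ?V| \<le>o |?V|"
    using card_of_Plus_infinite1[OF inf] ordIso_imp_ordLeq by blast
  then obtain j :: "'v + 'v \<times> 'v \<Rightarrow> 'v" where "inj_on j (?V <+> ?V \<times> ?V)"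
    unfolding card_of_ordLeq[symmetric] by blast
  moreover have "Inl ` ?V \<union> Inr ` rays \<subseteq> ?V <+> ?V \<times> ?V" using rays_arcs T.arcs_sub by auto
  ultimately show thesis using that[of j] inj_on_subset by blast
qed

end

section \<open>Construction of the tree with minimal valence\<close>

text \<open>
  The vertices over the orbit of \<open>v\<close> are blown up: each arc at \<open>v\<close> in the orbit of one of the
  chosen arcs representing \<open>M0\<close> gives a ray, and every arc at \<open>v\<close> is slid to the end of a ray
  whose stabilizer contains its own. The map \<open>j\<close> encodes the vertices of the new tree.
\<close>

locale expansion = peripheral_vertex G D G0 T v
  for G :: "('g, 'x) monoid_scheme" (structure)
    and D :: "('g, 'v) acted_graph set" and G0 T v +
  fixes u0 :: 'v and \<rho> :: "'v \<times> 'v \<Rightarrow> 'v \<times> 'v" and j :: "'v + 'v \<times> 'v \<Rightarrow> 'v"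
  assumes u0: "(v, u0) \<in> tarcs T"
    and \<rho>_rays: "e \<in> star_arcs \<Longrightarrow> \<rho> e \<in> rays"
    and fst_\<rho>: "e \<in> star_arcs \<Longrightarrow> fst (\<rho> e) = fst e"
    and \<rho>_id: "e \<in> rays \<Longrightarrow> \<rho> e = e"
    and \<rho>_act: "g \<in> carrier G \<Longrightarrow> e \<in> star_arcs \<Longrightarrow> \<rho> (arc_act T g e) = arc_act T g (\<rho> e)"
    and inj_j: "inj_on j (Inl ` tverts T \<union> Inr ` rays)"
begin

text \<open>\<open>Inl x\<close> is the centre over \<open>x\<close>, the only point over
  \<open>x\<close> when \<open>x\<close> is outside the orbit of \<open>v\<close>;
  \<open>Inr n\<close> is the far end of the ray named \<open>n\<close>.\<close>

definition pts where "pts = Inl ` tverts T \<union> Inr ` rays"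
definition W where "W = j ` pts"
definition dec where "dec = inv_into pts j"
definition sact where "sact g = map_sum (act T g) (arc_act T g)"
definition \<beta> where "\<beta> g = (\<lambda>w\<in>W. j (sact g (dec w)))"
definition ctr where "ctr x = j (Inl x)"
definition pr where "pr w = (case dec w of Inl x \<Rightarrow> x | Inr n \<Rightarrow> fst n)"
definition att where
  "att x y = j (if x \<in> orbit G (act T) v then Inr (\<rho> (x, y)) else Inl x)"

lemma inj_pts: "inj_on j pts" using inj_j by (simp add: pts_def)

lemma dec_j: "p \<in> pts \<Longrightarrow> dec (j p) = p" unfolding dec_def using inj_pts by (rule inv_into_f_f)

lemma j_eq_iff: "p \<in> pts \<Longrightarrow> q \<in> pts \<Longrightarrow> j p = j q \<longleftrightarrow> p = q"
  using inj_pts by (auto dest: inj_onD)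

lemma j_W: "p \<in> pts \<Longrightarrow> j p \<in> W" by (simp add: W_def)

lemma Inl_pts: "Inl x \<in> pts \<longleftrightarrow> x \<in> tverts T" and Inr_pts: "Inr n \<in> pts \<longleftrightarrow> n \<in> rays"
  by (auto simp: pts_def)

lemma sact_pts: "g \<in> carrier G \<Longrightarrow> p \<in> pts \<Longrightarrow> sact g p \<in> pts"
  using T.act_in rays_act by (auto simp: pts_def sact_def)

lemma \<beta>_j: "g \<in> carrier G \<Longrightarrow> p \<in> pts \<Longrightarrow> \<beta> g (j p) = j (sact g p)"
  by (simp add: \<beta>_def j_W dec_j)

lemma pr_Inl: "x \<in> tverts T \<Longrightarrow> pr (j (Inl x)) = x" and pr_Inr: "n \<in> rays \<Longrightarrow> pr (j (Inr n)) = fst n"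
  by (simp_all add: pr_def dec_j Inl_pts Inr_pts)

lemma W_cases:
  assumes "w \<in> W"
  obtains x where "x \<in> tverts T" "w = j (Inl x)" | n where "n \<in> rays" "w = j (Inr n)"
  using assms by (auto simp: W_def pts_def)

lemma ray_fst: "n \<in> rays \<Longrightarrow> fst n \<in> tverts T"
  using rays_arcs T.arcs_in by (cases n) auto

lemma pr_W: "w \<in> W \<Longrightarrow> pr w \<in> tverts T"
  by (erule W_cases) (auto simp: pr_Inl pr_Inr ray_fst)

lemma action: "group_action G W \<beta>"
proof (rule group_actionI[OF T.group_G])
  fix g w assume g: "g \<in> carrier G" and "w \<in> W"
  then obtain p where p: "p \<in> pts" "w = j p" by (auto simp: W_def)
  then show "\<beta> g w \<in> W" using \<beta>_j[OF g p(1)] j_W[OF sact_pts[OF g p(1)]] by simp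
next
  fix w assume "w \<in> W"
  then obtain p where p: "p \<in> pts" "w = j p" by (auto simp: W_def)
  have "sact \<one> p = p"
    using p(1) arc_act_one[OF subsetD[OF rays_arcs]] unfolding pts_def
    by (elim UnE imageE) (simp_all add: sact_def T.act_one)
  then show "\<beta> \<one> w = w" using \<beta>_j[OF P.one_closed p(1)] p by simp
next
  fix g h w assume g: "g \<in> carrier G" and h: "h \<in> carrier G" and "w \<in> W"
  then obtain p where p: "p \<in> pts" "w = j p" by (auto simp: W_def)
  have "sact (g \<otimes> h) p = sact g (sact h p)"
    using p(1) arc_act_mult[OF g h subsetD[OF rays_arcs]] unfolding pts_def
    by (elim UnE imageE) (simp_all add: sact_def T.act_mult g h)
  then show "\<beta> (g \<otimes> h) w = \<beta> g (\<beta> h w)"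
    using \<beta>_j[OF _ p(1)] \<beta>_j[OF g sact_pts[OF h p(1)]] g h p by simp
qed (simp add: \<beta>_def)

lemma star_arcs_iff: "(x, y) \<in> star_arcs \<longleftrightarrow> (x, y) \<in> tarcs T \<and> x \<in> orbit G (act T) v"
  by (simp add: star_arcs_def)

lemma att_star: "x \<in> orbit G (act T) v \<Longrightarrow> att x y = j (Inr (\<rho> (x, y)))"
  and att_other: "x \<notin> orbit G (act T) v \<Longrightarrow> att x y = j (Inl x)"
  by (simp_all add: att_def)

lemma att_pts:
  assumes "(x, y) \<in> tarcs T"
  obtains p where "p \<in> pts" "att x y = j p" "pr (j p) = x"
    "\<And>g. g \<in> carrier G \<Longrightarrow> att (act T g x) (act T g y) = j (sact g p)"
proof (cases "x \<in> orbit G (act T) v")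
  case True
  then have s: "(x, y) \<in> star_arcs" using assms star_arcs_iff by blast
  note r = \<rho>_rays[OF s]
  show thesis
  proof
    show "Inr (\<rho> (x, y)) \<in> pts" using r Inr_pts by blast
    show "att x y = j (Inr (\<rho> (x, y)))" using att_star[OF True] .
    show "pr (j (Inr (\<rho> (x, y)))) = x" using pr_Inr[OF r] fst_\<rho>[OF s] by simp
    show "att (act T g x) (act T g y) = j (sact g (Inr (\<rho> (x, y))))" if "g \<in> carrier G" for g
      using att_star[OF act_orbit[OF that True]] \<rho>_act[OF that s] by (simp add: sact_def)
  qed
next
  case False
  have x: "x \<in> tverts T" using assms T.arcs_in by blast
  show thesis
  proof
    show "Inl x \<in> pts" using x Inl_pts by blast
    show "att x y = j (Inl x)" using att_other[OF False] .
    show "pr (j (Inl x)) = x" using pr_Inl[OF x] .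
    show "att (act T g x) (act T g y) = j (sact g (Inl x))" if "g \<in> carrier G" for g
      using att_other act_orbit_iff[OF that x] False by (simp add: sact_def)
  qed
qed

text \<open>After sliding, a centre over the orbit of \<open>v\<close> carries rays only; with a
  single ray it would be a leaf and violate minimality. An element of \<open>G0\<close> that moves
  one ray supplies another.\<close>

lemma two_rays:
  assumes "x \<in> orbit G (act T) v"
  obtains n n' where "n \<in> rays" "n' \<in> rays" "fst n = x" "fst n' = x" "n \<noteq> n'"
proof -
  obtain g where g: "g \<in> carrier G" "x = act T g v" using assms by (auto simp: orbit_def)
  obtain w where w: "(v, w) \<in> rays" using dominating_ray[OF es_cand[OF u0]] .
  then have vw: "(v, w) \<in> tarcs T" using rays_arcs by blast
  obtain k where k: "k \<in> G0" "act T k w \<noteq> w" using moved_neighbour[OF vw] .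
  have kc: "k \<in> carrier G" "act T k v = v" using k mem_G0 by auto
  have "(v, act T k w) \<in> rays" using rays_act[OF kc(1) w] kc by simp
  then have "(x, act T g w) \<in> rays" "(x, act T g (act T k w)) \<in> rays"
    using rays_act[OF g(1)] w g(2) by fastforce+
  moreover have "act T g w \<noteq> act T g (act T k w)"
    using T.act_inj[OF g(1)] T.arcs_in(2)[OF vw] T.act_in[OF kc(1)] k(2) by metis
  ultimately show thesis using that by (metis fst_conv snd_conv)
qed

sublocale blow: blowup G "tverts T" "tarcs T" "act T" W ctr pr att \<beta>
proof (intro blowup.intro blowup_axioms.intro T.G_tree_axioms)
  show "group_action G W \<beta>" by (rule action)
  show "ctr x \<in> W" if "x \<in> tverts T" for x using that j_W Inl_pts by (simp add: ctr_def)
  show "pr w \<in> tverts T" if "w \<in> W" for w using that by (rule pr_W)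
  show "att x y \<in> W" if "(x, y) \<in> tarcs T" for x y using att_pts[OF that] j_W by metis
  show "pr (ctr x) = x" if "x \<in> tverts T" for x using pr_Inl[OF that] by (simp add: ctr_def)
  show "pr (att x y) = x" if "(x, y) \<in> tarcs T" for x y using att_pts[OF that] by metis
  show "\<beta> g (ctr x) = ctr (act T g x)" if "g \<in> carrier G" "x \<in> tverts T" for g x
    using \<beta>_j[OF that(1)] that(2) Inl_pts by (simp add: ctr_def sact_def)
  show "pr (\<beta> g w) = act T g (pr w)" if g: "g \<in> carrier G" and w: "w \<in> W" for g w
    using w
  proof (cases rule: W_cases)
    case (1 x)
    then show ?thesis
      using \<beta>_j[OF g, of "Inl x"] pr_Inl T.act_in[OF g] by (simp add: Inl_pts sact_def)
  next
    case (2 n)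
    then show ?thesis
      using \<beta>_j[OF g, of "Inr n"] pr_Inr rays_act[OF g] by (simp add: Inr_pts sact_def arc_act_fst)
  qed
  show "\<beta> g (att x y) = att (act T g x) (act T g y)" if g: "g \<in> carrier G" and xy: "(x, y) \<in> tarcs T" for g x y
    using att_pts[OF xy] \<beta>_j[OF g] g by metis
  show "\<exists>y. (pr w, y) \<in> tarcs T \<and> att (pr w) y = w" if w: "w \<in> W" "w \<noteq> ctr (pr w)" for w
    using w(1)
  proof (cases rule: W_cases)
    case (1 x)
    then show ?thesis using w pr_Inl by (simp add: ctr_def)
  next
    case (2 n)
    then obtain x y where n: "n = (x, y)" "(x, y) \<in> star_arcs"
      using rays_star by (cases n) auto
    \<comment> \<open>The ray \<open>n\<close> is also an arc of \<open>T\<close>; as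
      \<open>\<rho>\<close> fixes it, this arc is attached at the far end named by itself.\<close>
    then have "att x y = j (Inr n)" "(x, y) \<in> tarcs T"
      using att_star[of x y] \<rho>_id[of "(x, y)"] 2 star_arcs_iff by auto
    then show ?thesis using 2 n pr_Inr by auto
  qed
  show "(\<exists>y. (x, y) \<in> tarcs T \<and> att x y = ctr x) \<or>
      (\<exists>w\<in>W. \<exists>w'\<in>W. pr w = x \<and> pr w' = x \<and> w \<noteq> w' \<and> w \<noteq> ctr x \<and> w' \<noteq> ctr x)"
    if x: "x \<in> tverts T" for x
  proof (cases "x \<in> orbit G (act T) v")
    case True
    obtain n n' where n: "n \<in> rays" "n' \<in> rays" "fst n = x" "fst n' = x" "n \<noteq> n'"
      using two_rays[OF True] .
    then have "j (Inr n) \<in> W" "j (Inr n') \<in> W" "pr (j (Inr n)) = x" "pr (j (Inr n')) = x"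
      "j (Inr n) \<noteq> j (Inr n')" "j (Inr n) \<noteq> ctr x" "j (Inr n') \<noteq> ctr x"
      using j_W pr_Inr j_eq_iff x by (simp_all add: Inr_pts Inl_pts ctr_def)
    then show ?thesis by blast
  next
    case False
    \<comment> \<open>The first step towards \<open>v\<close> gives an arc at \<open>x\<close>, and
      outside the orbit of \<open>v\<close> arcs stay attached at the centre.\<close>
    then have "x \<noteq> v" using T.orbit_refl[OF v] by auto
    then obtain u where "(x, u) \<in> tarcs T" using T.closer_neighbour[OF v x] by blast
    then show ?thesis using att_other[OF False] by (auto simp: ctr_def)
  qed
qed

definition T' where "T' = \<lparr>graph_of = \<lparr>pverts = W, parcs = blow.barcs\<rparr>, act = \<beta>\<rparr>"

lemma T'_simps [simp]: "tverts T' = W" "tarcs T' = blow.barcs" "act T' = \<beta>"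
  by (simp_all add: T'_def)

lemma T'_tree: "is_G_tree G T'"
  using blow.blowup_G_tree by (simp add: is_G_tree_iff)

text \<open>The maps \<open>pr\<close> and \<open>ctr\<close> are equivariant, so fixed points pass
  in both directions.\<close>

lemma elliptic_T': "elliptic G T' H \<longleftrightarrow> elliptic G T H"
proof (cases "subgroup H G")
  case True
  have sub: "h \<in> carrier G" if "h \<in> H" for h using subgroup.mem_carrier[OF True that] .
  show ?thesis
  proof
    assume "elliptic G T' H"
    then obtain w where w: "w \<in> W" "\<And>h. h \<in> H \<Longrightarrow> \<beta> h w = w" by (auto simp: elliptic_def)
    then have "act T h (pr w) = pr w" if "h \<in> H" for h
      using blow.pr_act[OF sub[OF that] w(1)] that by simp
    then show "elliptic G T H" using True pr_W[OF w(1)] by (auto simp: elliptic_def)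
  next
    assume "elliptic G T H"
    then obtain x where x: "x \<in> tverts T" "\<And>h. h \<in> H \<Longrightarrow> act T h x = x" by (auto simp: elliptic_def)
    then have "\<beta> h (ctr x) = ctr x" if "h \<in> H" for h
      using blow.c_act[OF sub[OF that] x(1)] that by simp
    then show "elliptic G T' H" using True blow.c_in[OF x(1)] by (auto simp: elliptic_def)
  qed
qed (simp add: elliptic_def)

lemma ray_A:
  assumes "w \<in> W" "w \<noteq> ctr (pr w)"
  shows "{g \<in> carrier G. \<beta> g w = w} \<in> A"
  using assms(1)
proof (cases rule: W_cases)
  case (1 x)
  then show ?thesis using assms pr_Inl by (simp add: ctr_def)
next
  case (2 n)
  have "\<beta> g w = w \<longleftrightarrow> arc_act T g n = n" if g: "g \<in> carrier G" for g
    using \<beta>_j[OF g, of "Inr n"] j_eq_iff[of "Inr (arc_act T g n)" "Inr n"] 2 rays_act[OF g]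
    by (simp add: Inr_pts sact_def)
  then have "{g \<in> carrier G. \<beta> g w = w} = edge_stab G T n"
    by (auto simp: edge_stab_def stabilizer_def)
  then show ?thesis using edge_stab_A[OF subsetD[OF rays_arcs 2(1)]] by metis
qed

text \<open>Every edge group of \<open>T'\<close> is an edge group of \<open>T\<close>: lifts keep
  theirs, and a ray has that of the arc naming it.\<close>

lemma edge_stab_T'_A:
  assumes "(a, b) \<in> blow.barcs"
  shows "edge_stab G T' (a, b) \<in> A"
  using assms
proof cases
  case (lift x y)
  then have "edge_stab G T' (a, b) = edge_stab G T (x, y)"
    by (simp add: set_eq_iff blow.fix_lift_iff cong: conj_cong)
  then show ?thesis using edge_stab_A lift by simp
next
  case ray
  then have "edge_stab G T' (a, b) = {g \<in> carrier G. \<beta> g b = b}"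
    using blow.fix_ray by auto
  then show ?thesis using ray_A ray by simp
next
  case ray'
  then have "edge_stab G T' (a, b) = {g \<in> carrier G. \<beta> g a = a}"
    using blow.fix_ray by auto
  then show ?thesis using ray_A ray' by simp
qed

lemma T'_reduced_space: "T' \<in> reduced_deformation_space G D"
proof -
  have "T \<in> D" using T by (simp add: reduced_deformation_space_def)
  then have "T' \<in> D" using D T'_tree elliptic_T' by (auto simp: deformation_space_def)
  then show ?thesis using edge_stab_T'_A by (auto simp: reduced_deformation_space_def)
qed

lemma vertex_stab_T': "vertex_stab G T' (ctr v) = G0"
  using blow.fix_centre_iff[OF _ v] mem_G0 by auto

text \<open>Every arc at \<open>v\<close> has been slid off to the end of a ray, so no lift is
  attached at the centre.\<close>

lemma barcs_centre: "(ctr v, w) \<in> blow.barcs \<longleftrightarrow> (\<exists>u. (v, u) \<in> rays \<and> w = j (Inr (v, u)))"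
proof
  assume "(ctr v, w) \<in> blow.barcs"
  then show "\<exists>u. (v, u) \<in> rays \<and> w = j (Inr (v, u))"
  proof cases
    case (lift x y)
    have "x = v" using lift blow.pr_att blow.pr_c[OF v] by metis
    then have "(v, y) \<in> star_arcs" "ctr v = j (Inr (\<rho> (v, y)))"
      using lift att_star T.orbit_refl[OF v] star_arcs_iff by auto
    then have False
      using j_eq_iff[of "Inl v" "Inr (\<rho> (v, y))"] \<rho>_rays v by (simp add: ctr_def Inl_pts Inr_pts)
    then show ?thesis ..
  next
    case ray
    have prw: "pr w = v" using ray blow.pr_c[OF pr_W[of w]] blow.pr_c[OF v] by metis
    from ray(2) show ?thesis
    proof (cases rule: W_cases)
      case (1 x)
      then show ?thesis using ray pr_Inl by (simp add: ctr_def)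
    next
      case (2 n)
      then show ?thesis using prw pr_Inr by (cases n) auto
    qed
  next
    case ray'
    then show ?thesis using blow.pr_c[OF v] by simp
  qed
next
  assume "\<exists>u. (v, u) \<in> rays \<and> w = j (Inr (v, u))"
  then obtain u where u: "(v, u) \<in> rays" "w = j (Inr (v, u))" by blast
  then have "w \<in> W" "pr w = v" "w \<noteq> ctr v"
    using j_W pr_Inr j_eq_iff v by (simp_all add: Inr_pts Inl_pts ctr_def)
  then show "(ctr v, w) \<in> blow.barcs" using blow.barcs.ray[of w] by simp
qed

definition ray_orbit where "ray_orbit m = orbit G (arc_act T') (ctr v, j (Inr (v, edge_of m)))"

lemma edge_of_rays: "m \<in> M0 \<Longrightarrow> (v, edge_of m) \<in> rays"
  using rays_at_v[of "edge_of m"] T.act_one[OF T.arcs_in(2)[OF edge_of(1)]]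
    subgroup.one_closed[OF P.G0] by metis

lemma ray_orbit_eq_iff:
  assumes "(v, u) \<in> rays" "(v, u') \<in> rays"
  shows "orbit G (arc_act T') (ctr v, j (Inr (v, u))) = orbit G (arc_act T') (ctr v, j (Inr (v, u'))) \<longleftrightarrow>
    (\<exists>g\<in>G0. u' = act T g u)"
proof -
  have "(ctr v, j (Inr (v, u))) \<in> tarcs T'" "(ctr v, j (Inr (v, u'))) \<in> tarcs T'"
    using barcs_centre assms by auto
  note eq = arc_orbit_eq_iff[OF T'_tree this]
  have "ctr v = \<beta> g (ctr v) \<and> j (Inr (v, u')) = \<beta> g (j (Inr (v, u))) \<longleftrightarrow> act T g v = v \<and> u' = act T g u"
    if g: "g \<in> carrier G" for g
  proof -
    have "\<beta> g (j (Inr (v, u))) = j (Inr (act T g v, act T g u))"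
      using \<beta>_j[OF g, of "Inr (v, u)"] assms(1) by (simp add: Inr_pts sact_def)
    moreover have "(act T g v, act T g u) \<in> rays" using rays_act[OF g assms(1)] by simp
    then have "j (Inr (v, u')) = j (Inr (act T g v, act T g u)) \<longleftrightarrow> v = act T g v \<and> u' = act T g u"
      using j_eq_iff[of "Inr (v, u')" "Inr (act T g v, act T g u)"] assms(2) by (simp add: Inr_pts)
    ultimately show ?thesis using blow.fix_centre_iff[OF g v] by metis
  qed
  then have "(\<exists>g\<in>carrier G. ctr v = \<beta> g (ctr v) \<and> j (Inr (v, u')) = \<beta> g (j (Inr (v, u)))) \<longleftrightarrow>
      (\<exists>g\<in>carrier G. act T g v = v \<and> u' = act T g u)"
    by (intro bex_cong refl)
  also have "\<dots> \<longleftrightarrow> (\<exists>g\<in>G0. u' = act T g u)" unfolding Bex_def mem_G0 by blast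
  finally show ?thesis unfolding eq T'_simps .
qed

text \<open>The rays at the centre over \<open>v\<close> are the \<open>G0\<close>-translates of the
  chosen edges, which makes exactly one orbit per class.\<close>

lemma valence_T': "valence (quotient_graph G T') (orbit G (act T') (ctr v)) = enat (card M0)"
proof -
  have cW: "ctr v \<in> tverts T'" using blow.c_in[OF v] by simp
  have out: "out_arcs (quotient_graph G T') (orbit G (act T') (ctr v)) = ray_orbit ` M0"
    unfolding out_arcs_quotient_graph[OF T'_tree cW]
  proof (intro equalityI subsetI)
    fix X assume "X \<in> (\<lambda>w. orbit G (arc_act T') (ctr v, w)) ` {w. (ctr v, w) \<in> tarcs T'}"
    then obtain u where u: "(v, u) \<in> rays" "X = orbit G (arc_act T') (ctr v, j (Inr (v, u)))"
      using barcs_centre by auto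
    obtain g m where "g \<in> G0" "m \<in> M0" "u = act T g (edge_of m)" using rays_at_v u(1) by blast
    then have "X = ray_orbit m"
      using ray_orbit_eq_iff[OF edge_of_rays u(1)] u(2) unfolding ray_orbit_def by blast
    then show "X \<in> ray_orbit ` M0" using \<open>m \<in> M0\<close> by blast
  next
    fix X assume "X \<in> ray_orbit ` M0"
    then obtain m where m: "m \<in> M0" "X = ray_orbit m" by blast
    then have "(ctr v, j (Inr (v, edge_of m))) \<in> tarcs T'"
      using barcs_centre edge_of_rays by auto
    then show "X \<in> (\<lambda>w. orbit G (arc_act T') (ctr v, w)) ` {w. (ctr v, w) \<in> tarcs T'}"
      using m by (auto simp: ray_orbit_def)
  qed
  have "inj_on ray_orbit M0"
  proof (rule inj_onI)
    fix m m' assume m: "m \<in> M0" "m' \<in> M0" "ray_orbit m = ray_orbit m'"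
    then obtain g where "g \<in> G0" "edge_of m' = act T g (edge_of m)"
      using ray_orbit_eq_iff[OF edge_of_rays edge_of_rays] unfolding ray_orbit_def by blast
    then show "m = m'" using edge_of_orbit m by blast
  qed
  then show ?thesis
    using card_le_valence unfolding valence_def out_degree_def out
    by (simp add: card_image)
qed

end

context peripheral_vertex
begin

lemma valence_attained:
  "\<exists>T'\<in>reduced_deformation_space G D. \<exists>v'\<in>tverts T'.
     vertex_stab G T' v' = G0 \<and>
     valence (quotient_graph G T') (orbit G (act T') v') = enat (card M0)"
proof (cases "\<exists>u. (v, u) \<in> tarcs T")
  case True
  then obtain u where u: "(v, u) \<in> tarcs T" by blast
  obtain \<rho> where \<rho>: "\<And>e. e \<in> star_arcs \<Longrightarrow> \<rho> e \<in> rays" "\<And>e. e \<in> star_arcs \<Longrightarrow> fst (\<rho> e) = fst e"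
    "\<And>e. e \<in> rays \<Longrightarrow> \<rho> e = e"
    "\<And>g e. g \<in> carrier G \<Longrightarrow> e \<in> star_arcs \<Longrightarrow> \<rho> (arc_act T g e) = arc_act T g (\<rho> e)"
    using retraction by blast
  obtain j :: "'v + 'v \<times> 'v \<Rightarrow> 'v" where j: "inj_on j (Inl ` tverts T \<union> Inr ` rays)"
    using encoding[OF u] .
  interpret expansion G D G0 T v u \<rho> j
    by unfold_locales (use u \<rho> j in auto)
  show ?thesis using T'_reduced_space vertex_stab_T' valence_T' blow.c_in[OF v] T'_simps(1) by metis
next
  case False
  \<comment> \<open>Each class would provide an edge at \<open>v\<close>. Without edges there are no
    classes, and \<open>T\<close> itself attains equality.\<close>
  then have "M0 = {}" using peripheral_edge by blast
  moreover have "out_arcs (quotient_graph G T) (orbit G (act T) v) = {}"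
    unfolding out_arcs_quotient_graph[OF T_tree v] using False by blast
  ultimately have "valence (quotient_graph G T) (orbit G (act T) v) = enat (card M0)"
    by (simp add: valence_def out_degree_def)
  then show ?thesis using T v stab_v by blast
qed

end

theorem proposition4p10:
  fixes G :: "('g, 'x) monoid_scheme"
    and D :: "('g, 'v) acted_graph set"
    and G0 :: "'g set"
    and M0 :: "'g set set set"
    and T :: "('g, 'v) acted_graph"
    and v :: 'v
  assumes "finitely_generated_group G"
    and "deformation_space G D"
    and "maximal_elliptic G D G0"
    and "G0 \<notin> A_min G D"
    and "M0 = peripheral_structure G (A_min G D) G0"
    and "T \<in> reduced_deformation_space G D"
    and "v \<in> tverts T"
    and "vertex_stab G T v = G0"
  shows "(\<forall>e\<in>tarcs T. fst e = v \<longrightarrow> (\<exists>m\<in>M0. \<exists>K\<in>m. edge_stab G T e \<subseteq> K)) \<and>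
    (\<forall>m\<in>M0. \<exists>e\<in>tarcs T. fst e = v \<and> edge_stab G T e \<in> m) \<and>
    (finite M0 \<and> enat (card M0) \<le> valence (quotient_graph G T) (orbit G (act T) v)) \<and>
    (\<exists>T'\<in>reduced_deformation_space G D. \<exists>v'\<in>tverts T'.
       vertex_stab G T' v' = G0 \<and>
       valence (quotient_graph G T') (orbit G (act T') v') = enat (card M0))"
proof -
  interpret peripheral_vertex G D G0 T v
    using assms by unfold_locales
  have "\<exists>m\<in>M0. \<exists>K\<in>m. edge_stab G T e \<subseteq> K" if e: "e \<in> tarcs T" "fst e = v" for e
  proof -
    obtain u where u: "e = (v, u)" "(v, u) \<in> tarcs T" using e by (cases e) auto
    show ?thesis using dominating[OF es_cand[OF u(2)]] u(1) assms(5) by metis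
  qed
  moreover have "\<exists>e\<in>tarcs T. fst e = v \<and> edge_stab G T e \<in> m" if "m \<in> M0" for m
    using peripheral_edge[of m] that assms(5) by (metis fst_conv)
  ultimately show ?thesis
    using card_le_valence valence_attained unfolding assms(5) by blast
qed

end
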